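(* Moore's space $\mathscr L=\{w_\beta:\beta<\omega_1\}\subseteq\mathcal S^{\omega_1}$ is not a $Q$-set space.
   Context: Ordinals are identified with the set of smaller ordinals. A $C$-sequence is a sequence $\langle C_\alpha:\alpha<\omega_1\rangle$ with $C_0=\emptyset$, $C_{\beta+1}=\{\beta\}$, and, for each limit ordinal $\alpha>0$, $C_\alpha$ a cofinal subset of $\alpha$ such that $C_\alpha\cap\xi$ is finite for all $\xi<\alpha$. Fix an arbitrary $C$-sequence. Upper trace: for $\alpha\le\beta<\omega_1$, $U(\alpha,\alpha)=\emptyset$ and, for $\alpha<\beta$, $U(\alpha,\beta)=U(\alpha,\min(C_\beta\setminus\alpha))\cup\{\beta\}$. Lower trace: $L(\alpha,\alpha)=\emptyset$ and, for $\alpha<\beta$, $L(\alpha,\beta)=\big(L(\alpha,\min(C_\beta\setminus\alpha))\cup\{\max(C_\beta\cap\alpha)\}\big)\setminus\max(C_\beta\cap\alpha)$ if $C_\beta\cap\alpha\ne\emptyset$ (subtracting the ordinal $\max(C_\beta\cap\alpha)$ removes all elements smaller than it), and $L(\alpha,\beta)=L(\alpha,\min(C_\beta\setminus\alpha))$ if $C_\beta\cap\alpha=\emptyset$. For $\beta<\omega_1$ define $e_\beta:\beta\to\omega$ by $e_\beta(\alpha)=\max\{|C_\xi\cap\alpha|:\xi\in U(\alpha,\beta)\}$. For $\alpha<\beta<\omega_1$, $\operatorname{osc}(\alpha,\beta)$ is the number of $\zeta\in L(\alpha,\beta)\setminus\{\min L(\alpha,\beta)\}$ such that $e_\alpha(\zeta^{-})\le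 e_\beta(\zeta^{-})$ and $e_\alpha(\zeta)>e_\beta(\zeta)$, where $\zeta^{-}$ is the immediate predecessor of $\zeta$ in $L(\alpha,\beta)$ (so it is $0$ if $L(\alpha,\beta)=\emptyset$). Let $\mathcal S=\{z\in\mathbb C: z\overline z=1\}$, and fix a rationally independent family $\{z_\alpha:\alpha<\omega_1\}\subseteq\mathcal S$ (for distinct $\alpha_1,\dots,\alpha_k$ and integers $n_1,\dots,n_k$, $\prod_i z_{\alpha_i}^{n_i}=1$ only if all $n_i=0$). For $\alpha<\beta$ put $o(\alpha,\beta)=z_\alpha^{\operatorname{osc}(\alpha,\beta)+1}$. For $\beta<\omega_1$ let $w_\beta\in\mathcal S^{\omega_1}$ be given by $w_\beta(\alpha)=o(\alpha,\beta)$ if $\alpha<\beta$ and $w_\beta(\alpha)=1$ otherwise. $\mathscr L$ carries the subspace topology from the product $\mathcal S^{\omega_1}$. An uncountable regular topological space $X$ is a $Q$-set space if $X$ is not $\sigma$-discrete (not a countable union of discrete subspaces) and every subset of $X$ is a $G_\delta$ set. The statement is a theorem of ZFC. *)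

theory Defs
  imports "HOL-Analysis.Analysis" "HOL-Library.Countable_Set_Type"
begin

text \<open>Up to isomorphism, \<open>\<omega>\<^sub>1\<close> is the only uncountable well-order all of whose proper initial
  segments are countable. The ordinal \<open>\<alpha>\<close>, as a set of ordinals, is \<open>{..<\<alpha>}\<close>.\<close>

class omega1 = wellorder +
  assumes uncountable_UNIV: "\<not> countable (UNIV :: 'a set)"
    and countable_lessThan: "countable {..<\<alpha> :: 'a}"

text \<open>The class is inhabited: the carrier of the cardinal successor of \<open>natLeq\<close> is an instance.\<close>

lemma uncountable_Field_cardSuc_natLeq:
  includes cardinal_syntax
  shows "\<not> countable (Field (cardSuc natLeq))"
proof
  have co: "Card_order (cardSuc natLeq)"
    by (rule cardSuc_Card_order[OF natLeq_Card_order])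
  assume "countable (Field (cardSuc natLeq))"
  then have "|Field (cardSuc natLeq)| \<le>o natLeq"
    by (simp add: countable_card_le_natLeq)
  then have "cardSuc natLeq \<le>o natLeq"
    by (rule ordIso_ordLeq_trans[OF ordIso_symmetric[OF card_of_Field_ordIso[OF co]]])
  then show False
    using cardSuc_greater[OF natLeq_Card_order] not_ordLess_ordLeq by blast
qed

typedef aleph1 = "Field (cardSuc natLeq)"
proof -
  have "Field (cardSuc natLeq) \<noteq> {}"
    using uncountable_Field_cardSuc_natLeq by (metis countable_empty)
  then show ?thesis
    by blast
qed

instantiation aleph1 :: wellorder
begin

definition less_eq_aleph1 :: "aleph1 \<Rightarrow> aleph1 \<Rightarrow> bool"
  where "(x :: aleph1) \<le> y \<longleftrightarrow> (Rep_aleph1 x, Rep_aleph1 y) \<in> cardSuc natLeq"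

definition less_aleph1 :: "aleph1 \<Rightarrow> aleph1 \<Rightarrow> bool"
  where "(x :: aleph1) < y \<longleftrightarrow> x \<le> y \<and> x \<noteq> y"

instance
proof
  let ?r = "cardSuc natLeq"
  have co: "Card_order ?r"
    by (rule cardSuc_Card_order[OF natLeq_Card_order])
  then have wo: "well_order_on (Field ?r) ?r"
    by (simp add: card_order_on_def)
  then have refl: "refl_on (Field ?r) ?r" and trans: "trans ?r" and antisym: "antisym ?r"
    and total: "total_on (Field ?r) ?r" and wf: "wf (?r - Id)"
    by (auto simp: order_on_defs)
  have R: "Rep_aleph1 x \<in> Field ?r" for x
    by (rule Rep_aleph1)
  have inj: "Rep_aleph1 x = Rep_aleph1 y \<longleftrightarrow> x = y" for x y
    by (rule Rep_aleph1_inject)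
  fix x y z :: aleph1
  show "x \<le> x"
    using refl R by (auto simp: less_eq_aleph1_def refl_on_def)
  show "x \<le> z" if "x \<le> y" "y \<le> z"
    using that trans by (auto simp: less_eq_aleph1_def trans_def)
  show asym: "x = y" if "x \<le> y" "y \<le> x" for x y :: aleph1
    using antisymD[OF antisym that[unfolded less_eq_aleph1_def]] by (simp add: inj)
  show "x < y \<longleftrightarrow> x \<le> y \<and> \<not> y \<le> x"
    using asym[of x y] \<open>x \<le> x\<close> by (auto simp: less_aleph1_def)
  show "x \<le> y \<or> y \<le> x"
    using total R[of x] R[of y] \<open>x \<le> x\<close> inj[of x y]
    by (auto simp: less_eq_aleph1_def total_on_def)
  show "P a" if step: "\<And>x. (\<And>y. y < x \<Longrightarrow> P y) \<Longrightarrow> P x" for P and a :: aleph1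
  proof -
    have "wf (inv_image (?r - Id) Rep_aleph1)"
      by (rule wf_inv_image[OF wf])
    then show ?thesis
    proof (induction a rule: wf_induct_rule)
      case (less x)
      show ?case
        by (rule step, rule less) (auto simp: less_aleph1_def less_eq_aleph1_def inj)
    qed
  qed
qed

end

instance aleph1 :: omega1
proof
  have "Rep_aleph1 ` UNIV = Field (cardSuc natLeq)"
    by (rule type_definition.Rep_range[OF type_definition_aleph1])
  then show "\<not> countable (UNIV :: aleph1 set)"
    using uncountable_Field_cardSuc_natLeq countable_image[of UNIV Rep_aleph1] by auto
next
  include cardinal_syntax
  fix x :: aleph1
  have "|underS (cardSuc natLeq) (Rep_aleph1 x)| \<le>o natLeq"
    using card_of_underS[OF cardSuc_Card_order[OF natLeq_Card_order] Rep_aleph1]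
      cardSuc_ordLeq_ordLess[OF natLeq_Card_order card_of_Card_order] by blast
  then have "countable (underS (cardSuc natLeq) (Rep_aleph1 x))"
    by (simp add: countable_card_le_natLeq)
  moreover have "Rep_aleph1 ` {..<x} \<subseteq> underS (cardSuc natLeq) (Rep_aleph1 x)"
    by (auto simp: underS_def less_aleph1_def less_eq_aleph1_def Rep_aleph1_inject)
  ultimately have "countable (Rep_aleph1 ` {..<x})"
    by (rule countable_subset[rotated])
  then show "countable {..<x}"
    by (rule countable_image_inj_on) (simp add: inj_on_def Rep_aleph1_inject)
qed

text \<open>In the assumptions below \<open>{..<\<alpha>} = {}\<close> means \<open>\<alpha> = 0\<close>, and \<open>{..<\<alpha>} = {..\<beta>}\<close> means
  \<open>\<alpha> = \<beta> + 1\<close>.\<close>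

definition limit_ordinal :: "'a::omega1 \<Rightarrow> bool"
  where "limit_ordinal \<alpha> \<longleftrightarrow> {..<\<alpha>} \<noteq> {} \<and> (\<nexists>\<beta>. {..<\<alpha>} = {..\<beta>})"

locale C_sequence =
  fixes C :: "'a::omega1 \<Rightarrow> 'a set"
  assumes C_zero: "{..<\<alpha>} = {} \<Longrightarrow> C \<alpha> = {}"
    and C_succ: "{..<\<alpha>} = {..\<beta>} \<Longrightarrow> C \<alpha> = {\<beta>}"
    and C_limit_subset: "limit_ordinal \<alpha> \<Longrightarrow> C \<alpha> \<subseteq> {..<\<alpha>}"
    and C_limit_cofinal: "limit_ordinal \<alpha> \<Longrightarrow> \<xi> < \<alpha> \<Longrightarrow> \<exists>\<gamma>\<in>C \<alpha>. \<xi> \<le> \<gamma>"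
    and C_limit_finite: "limit_ordinal \<alpha> \<Longrightarrow> \<xi> < \<alpha> \<Longrightarrow> finite (C \<alpha> \<inter> {..<\<xi>})"
begin

text \<open>\<open>next_step \<alpha> \<beta>\<close> is \<open>min (C\<^sub>\<beta> \<setminus> \<alpha>)\<close>; the set may be infinite, so \<open>Min\<close> is not applicable.\<close>

definition next_step :: "'a \<Rightarrow> 'a \<Rightarrow> 'a"
  where "next_step \<alpha> \<beta> = (LEAST \<gamma>. \<gamma> \<in> C \<beta> - {..<\<alpha>})"

lemma C_subset: "C \<beta> \<subseteq> {..<\<beta>}"
  using C_zero[of \<beta>] C_succ[of \<beta>] C_limit_subset[of \<beta>]
  by (fastforce simp: limit_ordinal_def)

lemma C_cofinal:
  assumes "\<alpha> < \<beta>"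
  shows "\<exists>\<gamma>\<in>C \<beta>. \<alpha> \<le> \<gamma>"
proof (cases "\<exists>\<delta>. {..<\<beta>} = {..\<delta>}")
  case True
  then show ?thesis
    using C_succ assms by (metis atMost_iff lessThan_iff singletonI)
next
  case False
  then have "limit_ordinal \<beta>"
    using assms by (auto simp: limit_ordinal_def)
  then show ?thesis
    using assms by (rule C_limit_cofinal)
qed

lemma next_step_mem:
  assumes "\<alpha> < \<beta>"
  shows "next_step \<alpha> \<beta> \<in> C \<beta> - {..<\<alpha>}"
  unfolding next_step_def using C_cofinal[OF assms] by (metis DiffI LeastI lessThan_iff not_le)

lemma next_step_less: "\<alpha> < \<beta> \<Longrightarrow> next_step \<alpha> \<beta> < \<beta>"
  using next_step_mem C_subset by blast

text \<open>The traces are only meaningful for \<open>\<alpha> \<le> \<beta>\<close>; they are set to \<open>{}\<close> for \<open>\<beta> < \<alpha>\<close>.\<close>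

function upper_trace :: "'a \<Rightarrow> 'a \<Rightarrow> 'a set"
  where "upper_trace \<alpha> \<beta> =
    (if \<alpha> < \<beta> then upper_trace \<alpha> (next_step \<alpha> \<beta>) \<union> {\<beta>} else {})"
  by auto
termination
  by (relation "inv_image {(x, y). x < y} snd") (auto intro: next_step_less wf)

function lower_trace :: "'a \<Rightarrow> 'a \<Rightarrow> 'a set"
  where "lower_trace \<alpha> \<beta> =
    (if \<alpha> < \<beta> then
       if C \<beta> \<inter> {..<\<alpha>} \<noteq> {}
       then (lower_trace \<alpha> (next_step \<alpha> \<beta>) \<union> {Max (C \<beta> \<inter> {..<\<alpha>})}) - {..<Max (C \<beta> \<inter> {..<\<alpha>})}
       else lower_trace \<alpha> (next_step \<alpha> \<beta>)
     else {})"
  by auto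
termination
  by (relation "inv_image {(x, y). x < y} snd") (auto intro: next_step_less wf)

declare upper_trace.simps [simp del] lower_trace.simps [simp del]

definition e :: "'a \<Rightarrow> 'a \<Rightarrow> nat"
  where "e \<beta> \<alpha> = Max ((\<lambda>\<xi>. card (C \<xi> \<inter> {..<\<alpha>})) ` upper_trace \<alpha> \<beta>)"

definition osc :: "'a \<Rightarrow> 'a \<Rightarrow> nat"
  where "osc \<alpha> \<beta> = card {\<zeta> \<in> lower_trace \<alpha> \<beta> - {Min (lower_trace \<alpha> \<beta>)}.
    let \<zeta>' = Max {\<eta> \<in> lower_trace \<alpha> \<beta>. \<eta> < \<zeta>}
    in e \<alpha> \<zeta>' \<le> e \<beta> \<zeta>' \<and> e \<alpha> \<zeta> > e \<beta> \<zeta>}"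

end

definition unit_circle :: "complex set"
  where "unit_circle = {z. z * cnj z = 1}"

definition rationally_independent :: "('i \<Rightarrow> complex) \<Rightarrow> bool"
  where "rationally_independent z \<longleftrightarrow>
    (\<forall>A n. finite A \<longrightarrow> (\<Prod>\<alpha>\<in>A. z \<alpha> powi (n \<alpha>)) = 1 \<longrightarrow> (\<forall>\<alpha>\<in>A. n \<alpha> = 0))"

context C_sequence
begin

definition o_fun :: "('a \<Rightarrow> complex) \<Rightarrow> 'a \<Rightarrow> 'a \<Rightarrow> complex"
  where "o_fun z \<alpha> \<beta> = z \<alpha> ^ (osc \<alpha> \<beta> + 1)"

definition w :: "('a \<Rightarrow> complex) \<Rightarrow> 'a \<Rightarrow> 'a \<Rightarrow> complex"
  where "w z \<beta> = (\<lambda>\<alpha>. if \<alpha> < \<beta> then o_fun z \<alpha> \<beta> else 1)"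

definition moore_space :: "('a \<Rightarrow> complex) \<Rightarrow> ('a \<Rightarrow> complex) topology"
  where "moore_space z =
    subtopology (product_topology (\<lambda>_. top_of_set unit_circle) UNIV) (range (w z))"

end

definition discrete_subspace :: "'b topology \<Rightarrow> 'b set \<Rightarrow> bool"
  where "discrete_subspace X D \<longleftrightarrow> D \<subseteq> topspace X \<and> subtopology X D = discrete_topology D"

definition sigma_discrete :: "'b topology \<Rightarrow> bool"
  where "sigma_discrete X \<longleftrightarrow>
    (\<exists>\<D>. countable \<D> \<and> (\<forall>D\<in>\<D>. discrete_subspace X D) \<and> \<Union>\<D> = topspace X)"

definition Q_set_space :: "'b topology \<Rightarrow> bool"
  where "Q_set_space X \<longleftrightarrow>
    uncountable (topspace X) \<and> regular_space X \<and> \<not> sigma_discrete X \<and>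
    (\<forall>S. S \<subseteq> topspace X \<longrightarrow> gdelta_in X S)"

end

theory Submission
  imports Defs
begin

text \<open>The space fails to be a \<open>Q\<close>-set space because its \<open>G\<^sub>\<delta>\<close> subsets are too simple: each of them is
  decided by countably many coordinates, while some subset of the space is not.

  A subset \<open>S\<close> is decided below \<open>\<delta>\<close> if any two points that agree on all coordinates below \<open>\<delta>\<close> lie
  both in \<open>S\<close> or both outside \<open>S\<close>. For a fixed \<open>\<delta>\<close> the points have only countably many
  restrictions to \<open>\<delta>\<close> (\<open>countable_osc_restrictions\<close>): for a limit \<open>\<delta> \<le> \<beta>\<close> and for \<open>\<alpha> < \<delta>\<close> close
  to \<open>\<delta>\<close>, the trace \<open>L(\<alpha>,\<beta>)\<close> is \<open>L(\<delta>,\<beta>) \<union> L(\<alpha>,\<delta>)\<close>, and \<open>e\<^sub>\<beta>\<close> differs from \<open>e\<^sub>\<delta>\<close> only finitely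
  often below \<open>\<delta>\<close>, so that \<open>\<beta>\<close> enters \<open>osc(\<alpha>,\<beta>)\<close> through finitely much information. Hence above
  every \<open>\<delta>\<close> there are two points that agree below \<open>\<delta>\<close>. Choosing such pairs disjointly for
  uncountably many \<open>\<delta>\<close> and collecting one point of each pair gives a set that is decided below no
  countable ordinal (\<open>undetermined_set_exists\<close>).

  That open sets, and therefore \<open>G\<^sub>\<delta>\<close> sets, are decided below some \<open>\<delta>\<close> is the Lindelof property of
  open subspaces, which is Moore's theorem (\<open>countable_subcover\<close>). If it failed, there would be
  uncountably many points with basic neighbourhoods such that no neighbourhood contains a later
  point. After a pressing-down argument the neighbourhoods restrict the same finite set of
  coordinates on which all the points agree, and in addition finite sets of coordinates that move
  up to \<open>\<omega>\<^sub>1\<close>. Moore's oscillation theorem (\<open>osc_increments\<close>) provides one such finite set \<open>a\<close> and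
  later points \<open>\<beta>\<^sub>0, \<dots>, \<beta>\<^sub>n\<close> with \<open>osc(\<alpha>,\<beta>\<^sub>m) = osc(\<alpha>,\<beta>\<^sub>0) + m\<close> for all \<open>\<alpha> \<in> a\<close> simultaneously. Along
  \<open>m\<close> the values of the points at \<open>a\<close> are therefore multiplied by \<open>z\<^sub>\<alpha>\<^sup>m\<close>, and by Kronecker's
  theorem a long enough piece of such an orbit enters every prescribed box of the torus, wherever
  it starts (\<open>powers_uniformly_dense_in_torus\<close>). So some \<open>\<beta>\<^sub>m\<close> does lie in the neighbourhood.

  The oscillation theorem is proved over one limit ordinal \<open>\<delta>\<close> that behaves like the intersection
  of \<open>\<omega>\<^sub>1\<close> with a countable elementary submodel (\<open>reflecting_exists\<close>). Indices above \<open>\<delta>\<close> are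
  replaced step by step so that \<open>L(\<delta>,b)\<close> grows by a block on which \<open>e\<^sub>a\<close> and \<open>e\<^sub>b\<close> agree, then by a
  block on which \<open>e\<^sub>a\<close> is larger (\<open>step_equal\<close>, \<open>step_greater\<close>); each such pair of blocks adds
  exactly one oscillation. Finally the last \<open>a\<close> is reflected below \<open>\<delta>\<close>, where the remaining part
  \<open>L(\<alpha>,\<delta>)\<close> of the trace contributes the same amount for all the \<open>b\<close>'s.\<close>

section \<open>Countable ordinals and reflection\<close>

lemma countable_imp_strictly_bounded:
  fixes X :: "'a::omega1 set"
  assumes "countable X"
  obtains \<eta> where "\<And>x. x \<in> X \<Longrightarrow> x < \<eta>"
proof -
  have "countable (\<Union>x\<in>X. {..x})"
    using assms countable_lessThan by (auto simp flip: ivl_disj_un_singleton(2))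
  then obtain \<eta> where "\<eta> \<notin> (\<Union>x\<in>X. {..x})"
    using uncountable_UNIV by (metis UNIV_eq_I)
  then show ?thesis
    by (intro that[of \<eta>]) (auto simp: not_le)
qed

lemma limit_ordinalI:
  assumes "\<xi>\<^sub>0 < \<delta>" and "\<And>\<xi>. \<xi> < \<delta> \<Longrightarrow> \<exists>\<eta>>\<xi>. \<eta> < \<delta>"
  shows "limit_ordinal \<delta>"
  using assms unfolding limit_ordinal_def by (metis atMost_iff empty_iff lessThan_iff not_le order_refl)

lemma limit_ordinal_dense:
  assumes "limit_ordinal \<delta>" and "\<xi> < \<delta>"
  obtains \<eta> where "\<xi> < \<eta>" "\<eta> < \<delta>"
proof -
  have "{..<\<delta>} \<noteq> {..\<xi>}"
    using assms(1) by (auto simp: limit_ordinal_def)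
  then show ?thesis
    using assms(2) that by (metis atMost_iff lessThan_iff linorder_not_less order_le_less_trans set_eqI)
qed

lemma limit_ordinal_strictly_bounds_finite:
  assumes "limit_ordinal \<delta>" and "finite X" and "X \<subseteq> {..<\<delta>}"
  obtains \<eta> where "\<eta> < \<delta>" and "\<And>x. x \<in> X \<Longrightarrow> x < \<eta>"
proof (cases "X = {}")
  case True
  then show ?thesis
    using assms(1) that by (auto simp: limit_ordinal_def)
next
  case False
  then have "Max X < \<delta>"
    using assms by (meson Max_in lessThan_iff subsetD)
  then show ?thesis
    using limit_ordinal_dense[OF assms(1)] that assms(2) by (metis Max_ge le_less_trans)
qed

lemma limit_of_iterates:
  fixes f :: "'a::omega1 \<Rightarrow> 'a"
  assumes incr: "\<And>\<gamma>. \<gamma> < f \<gamma>"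
  obtains \<delta> where "\<And>n. (f ^^ n) \<eta> < \<delta>" "\<And>\<gamma>. \<gamma> < \<delta> \<Longrightarrow> \<exists>n. \<gamma> < (f ^^ n) \<eta>"
proof -
  have "countable (range (\<lambda>n. (f ^^ n) \<eta>))"
    by simp
  then obtain b where b: "\<And>n. (f ^^ n) \<eta> < b"
    by (rule countable_imp_strictly_bounded) auto
  define \<delta> where "\<delta> = (LEAST x. \<forall>n. (f ^^ n) \<eta> \<le> x)"
  have le: "(f ^^ n) \<eta> \<le> \<delta>" for n
    unfolding \<delta>_def by (rule LeastI2[of _ b]) (use b in \<open>auto simp: less_imp_le\<close>)
  show ?thesis
  proof
    show "(f ^^ n) \<eta> < \<delta>" for n
      using le[of "Suc n"] incr[of "(f ^^ n) \<eta>"] by simp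
    show "\<exists>n. \<gamma> < (f ^^ n) \<eta>" if "\<gamma> < \<delta>" for \<gamma>
      using not_less_Least[OF that[unfolded \<delta>_def]] by (simp add: not_le)
  qed
qed

definition unbounded :: "'a::order set \<Rightarrow> bool"
  where "unbounded P \<longleftrightarrow> (\<forall>\<xi>. \<exists>x\<in>P. \<xi> < x)"

text \<open>A combinatorial substitute for \<open>\<delta> = M \<inter> \<omega>\<^sub>1\<close> with \<open>M\<close> a countable elementary submodel: \<open>\<P> \<gamma>\<close>
  lists the sets that are definable from parameters below \<open>\<gamma>\<close>, and such a set is unbounded, also
  within \<open>\<delta>\<close>, as soon as it has a single element that \<open>M\<close> cannot reach.\<close>

definition reflecting :: "('a::omega1 \<Rightarrow> 'a set set) \<Rightarrow> 'a \<Rightarrow> bool"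
  where "reflecting \<P> \<delta> \<longleftrightarrow> limit_ordinal \<delta> \<and>
    (\<forall>\<gamma><\<delta>. \<forall>P\<in>\<P> \<gamma>. (\<exists>x\<in>P. \<delta> \<le> x) \<longrightarrow> unbounded P \<and> (\<forall>\<xi><\<delta>. \<exists>x\<in>P. \<xi> < x \<and> x < \<delta>))"

text \<open>For \<open>P \<in> \<P> \<gamma>'\<close> and \<open>\<gamma>' \<le> \<gamma>\<close> the value \<open>g P \<gamma>\<close> is the ordinal that \<open>\<delta>\<close> must exceed: a bound of \<open>P\<close> if
  there is one, otherwise the next element of \<open>P\<close> after \<open>\<gamma>\<close>. As only countably many such values
  arise for each \<open>\<gamma>\<close>, a limit of iterates of a function dominating them is closed under \<open>g\<close>.\<close>

theorem reflecting_exists: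
  fixes \<P> :: "'a::omega1 \<Rightarrow> 'a set set"
  assumes cnt: "\<And>\<gamma>. countable (\<P> \<gamma>)"
  obtains \<delta> where "reflecting \<P> \<delta>" and "\<eta> < \<delta>"
proof -
  define g where "g P \<gamma> = (if unbounded P then LEAST x. x \<in> P \<and> \<gamma> < x else LEAST b. \<forall>x\<in>P. x \<le> b)"
    for P and \<gamma> :: 'a
  have "\<exists>b>\<gamma>. \<forall>\<gamma>'\<le>\<gamma>. \<forall>P\<in>\<P> \<gamma>'. g P \<gamma> < b" for \<gamma>
  proof -
    have "countable (insert \<gamma> (\<Union>\<gamma>'\<in>{..\<gamma>}. (\<lambda>P. g P \<gamma>) ` \<P> \<gamma>'))"
      using cnt countable_lessThan by (auto simp flip: ivl_disj_un_singleton(2))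
    then obtain b where b: "\<And>x. x \<in> insert \<gamma> (\<Union>\<gamma>'\<in>{..\<gamma>}. (\<lambda>P. g P \<gamma>) ` \<P> \<gamma>') \<Longrightarrow> x < b"
      by (rule countable_imp_strictly_bounded) blast
    then show ?thesis
      by (intro exI[of _ b]) auto
  qed
  then obtain f where incr: "\<And>\<gamma>. \<gamma> < f \<gamma>"
    and f: "\<And>\<gamma> \<gamma>' P. \<gamma>' \<le> \<gamma> \<Longrightarrow> P \<in> \<P> \<gamma>' \<Longrightarrow> g P \<gamma> < f \<gamma>"
    by metis
  obtain \<delta> where below: "\<And>n. (f ^^ n) \<eta> < \<delta>" and above: "\<And>\<gamma>. \<gamma> < \<delta> \<Longrightarrow> \<exists>n. \<gamma> < (f ^^ n) \<eta>"
    using limit_of_iterates[of f, OF incr] by blast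
  have \<eta>: "\<eta> < \<delta>"
    using below[of 0] by simp
  have lim: "limit_ordinal \<delta>"
    by (rule limit_ordinalI[OF \<eta>]) (meson above below less_trans)
  have "unbounded P \<and> (\<forall>\<xi><\<delta>. \<exists>x\<in>P. \<xi> < x \<and> x < \<delta>)"
    if \<gamma>: "\<gamma> < \<delta>" and P: "P \<in> \<P> \<gamma>" and x: "x \<in> P" "\<delta> \<le> x" for \<gamma> P x
  proof -
    have ex: "\<exists>\<gamma>'. \<xi> < \<gamma>' \<and> \<gamma>' < \<delta> \<and> g P \<gamma>' < \<delta>" if "\<xi> < \<delta>" for \<xi>
    proof -
      have "max \<gamma> \<xi> < \<delta>"
        using \<gamma> that by simp
      then obtain n where n: "max \<gamma> \<xi> < (f ^^ n) \<eta>"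
        using above by blast
      then have "g P ((f ^^ n) \<eta>) < (f ^^ Suc n) \<eta>"
        using f[of \<gamma> "(f ^^ n) \<eta>" P] P by (simp add: less_imp_le)
      then show ?thesis
        using below[of n] below[of "Suc n"] n by (metis max_less_iff_conj less_trans)
    qed
    have unb: "unbounded P"
    proof (rule ccontr)
      assume nu: "\<not> unbounded P"
      then obtain b where b: "\<forall>x\<in>P. x \<le> b"
        by (auto simp: unbounded_def not_less)
      from LeastI[of "\<lambda>b. \<forall>x\<in>P. x \<le> b", OF this] have "x \<le> g P \<gamma>'" for \<gamma>'
        unfolding g_def using nu x by simp
      then show False
        using ex[OF \<eta>] x by (meson leD le_less_trans)
    qed
    moreover have "\<exists>x\<in>P. \<xi> < x \<and> x < \<delta>" if \<xi>: "\<xi> < \<delta>" for \<xi>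
    proof -
      obtain \<gamma>' where \<gamma>': "\<xi> < \<gamma>'" "\<gamma>' < \<delta>" "g P \<gamma>' < \<delta>"
        using ex[OF \<xi>] by blast
      have "\<exists>x. x \<in> P \<and> \<gamma>' < x"
        using unb by (auto simp: unbounded_def)
      from LeastI_ex[OF this] have "g P \<gamma>' \<in> P \<and> \<gamma>' < g P \<gamma>'"
        unfolding g_def using unb by simp
      then show ?thesis
        using \<gamma>' by (meson less_trans)
    qed
    ultimately show ?thesis
      by blast
  qed
  then have "reflecting \<P> \<delta>"
    unfolding reflecting_def using lim by blast
  then show ?thesis
    using that \<eta> by blast
qed

lemma reflectingD:
  assumes "reflecting \<P> \<delta>" "\<gamma> < \<delta>" "P \<in> \<P> \<gamma>" "x \<in> P" "\<delta> \<le> x"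
  shows "unbounded P" and "\<And>\<xi>. \<xi> < \<delta> \<Longrightarrow> \<exists>x\<in>P. \<xi> < x \<and> x < \<delta>"
  using assms unfolding reflecting_def by blast+

lemma reflecting_limit: "reflecting \<P> \<delta> \<Longrightarrow> limit_ordinal \<delta>"
  by (simp add: reflecting_def)

text \<open>Listing the singleton of \<open>f \<gamma>\<close> among the reflected sets makes \<open>\<delta>\<close> closed under the function
  \<open>f\<close>, because a singleton is never unbounded.\<close>

lemma reflecting_singleton:
  assumes "reflecting \<P> \<delta>" "\<gamma> < \<delta>" "{x} \<in> \<P> \<gamma>"
  shows "x < \<delta>"
  using reflectingD[OF assms, of x] by (fastforce simp: unbounded_def not_less)

context C_sequence
begin

section \<open>Lower traces\<close>

lemma finite_C_below:
  assumes "\<alpha> < \<beta>"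
  shows "finite (C \<beta> \<inter> {..<\<alpha>})"
proof (cases "limit_ordinal \<beta>")
  case True
  then show ?thesis
    using C_limit_finite assms by blast
next
  case False
  then show ?thesis
    using assms C_succ[of \<beta>] by (auto simp: limit_ordinal_def)
qed

lemma next_step_ge: "\<alpha> < \<beta> \<Longrightarrow> \<alpha> \<le> next_step \<alpha> \<beta>"
  using next_step_mem[of \<alpha> \<beta>] by auto

lemma next_step_le: "\<gamma> \<in> C \<beta> \<Longrightarrow> \<alpha> \<le> \<gamma> \<Longrightarrow> next_step \<alpha> \<beta> \<le> \<gamma>"
  unfolding next_step_def by (rule Least_le) auto

lemma next_step_cong:
  assumes "C \<beta> \<inter> {..<\<alpha>} = C \<beta> \<inter> {..<\<alpha>'}"
  shows "next_step \<alpha> \<beta> = next_step \<alpha>' \<beta>"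
proof -
  have "C \<beta> - {..<\<alpha>} = C \<beta> - {..<\<alpha>'}"
    using assms by blast
  then show ?thesis
    by (simp add: next_step_def)
qed

lemma C_below_next_step:
  assumes "\<alpha> < \<beta>"
  shows "C \<beta> \<inter> {..<next_step \<alpha> \<beta>} = C \<beta> \<inter> {..<\<alpha>}"
proof -
  have "\<gamma> < \<alpha>" if "\<gamma> \<in> C \<beta>" "\<gamma> < next_step \<alpha> \<beta>" for \<gamma>
    using next_step_le[OF that(1), of \<alpha>] that(2) by (meson leD not_le)
  then show ?thesis
    using next_step_ge[OF assms] by auto
qed

lemma lower_trace_self [simp]: "lower_trace \<alpha> \<alpha> = {}"
  by (simp add: lower_trace.simps)

lemma lower_trace_step:
  assumes "\<alpha> < \<beta>" "C \<beta> \<inter> {..<\<alpha>} = {}"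
  shows "lower_trace \<alpha> \<beta> = lower_trace \<alpha> (next_step \<alpha> \<beta>)"
  using assms by (subst lower_trace.simps) auto

lemma lower_trace_step_Max:
  assumes "\<alpha> < \<beta>" "C \<beta> \<inter> {..<\<alpha>} \<noteq> {}"
  shows "lower_trace \<alpha> \<beta> =
    insert (Max (C \<beta> \<inter> {..<\<alpha>})) (lower_trace \<alpha> (next_step \<alpha> \<beta>) - {..<Max (C \<beta> \<inter> {..<\<alpha>})})"
  using assms by (subst lower_trace.simps) auto

lemma finite_lower_trace: "finite (lower_trace \<alpha> \<beta>)"
proof (induction \<beta> rule: less_induct)
  case (less \<beta>)
  show ?case
    using less[OF next_step_less] by (subst lower_trace.simps) auto
qed

lemma lower_trace_subset: "lower_trace \<alpha> \<beta> \<subseteq> {..<\<alpha>}"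
proof (induction \<beta> rule: less_induct)
  case (less \<beta>)
  have "Max (C \<beta> \<inter> {..<\<alpha>}) < \<alpha>" if "\<alpha> < \<beta>" "C \<beta> \<inter> {..<\<alpha>} \<noteq> {}"
    using Max_in[OF finite_C_below that(2)] that(1) by auto
  then show ?case
    using less[OF next_step_less] by (subst lower_trace.simps) auto
qed

text \<open>The walk from \<open>\<gamma>\<close> to \<open>\<alpha>\<close> passes through \<open>\<beta>\<close>. Every maximum \<open>max(C\<^sub>\<xi> \<inter> \<beta>)\<close> met on the walk from \<open>\<gamma>\<close>
  to \<open>\<beta>\<close> is bounded by an element of \<open>L(\<beta>,\<gamma>)\<close>, hence lies below \<open>L(\<alpha>,\<beta>)\<close> and so below \<open>\<alpha>\<close>;
  thus \<open>C\<^sub>\<xi>\<close> has no element between \<open>\<alpha>\<close> and \<open>\<beta>\<close>, and both walks take the same step at \<open>\<xi>\<close>.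
  Nonemptiness of \<open>L(\<alpha>,\<beta>)\<close> is what turns the order assumption into a bound by \<open>\<alpha>\<close>.\<close>

lemma lower_trace_concat:
  assumes "\<alpha> \<le> \<beta>" "\<beta> \<le> \<gamma>" "lower_trace \<alpha> \<beta> \<noteq> {}"
    and "\<And>\<xi> \<eta>. \<xi> \<in> lower_trace \<beta> \<gamma> \<Longrightarrow> \<eta> \<in> lower_trace \<alpha> \<beta> \<Longrightarrow> \<xi> < \<eta>"
  shows "lower_trace \<alpha> \<gamma> = lower_trace \<beta> \<gamma> \<union> lower_trace \<alpha> \<beta>"
  using assms(2,4)
proof (induction \<gamma> rule: less_induct)
  case (less \<gamma>)
  show ?case
  proof (cases "\<beta> = \<gamma>")
    case True
    then show ?thesis
      by simp
  next
    case False
    then have lt: "\<beta> < \<gamma>" "\<alpha> < \<gamma>"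
      using less.prems assms(1) by auto
    have below: "C \<gamma> \<inter> {..<\<alpha>} = C \<gamma> \<inter> {..<\<beta>}"
    proof (cases "C \<gamma> \<inter> {..<\<beta>} = {}")
      case True
      then show ?thesis
        using assms(1) by auto
    next
      case ne: False
      let ?m = "Max (C \<gamma> \<inter> {..<\<beta>})"
      obtain \<eta> where \<eta>: "\<eta> \<in> lower_trace \<alpha> \<beta>"
        using assms(3) by blast
      have "?m < \<eta>"
        using less.prems(2)[OF _ \<eta>] lower_trace_step_Max[OF lt(1) ne] by blast
      then have "?m < \<alpha>"
        using lower_trace_subset \<eta> by (metis lessThan_iff less_trans subsetD)
      then show ?thesis
        using Max_ge[OF finite_C_below[OF lt(1)]] assms(1) by fastforce
    qed
    have step: "next_step \<alpha> \<gamma> = next_step \<beta> \<gamma>"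
      by (rule next_step_cong[OF below])
    note IH = less.IH[OF next_step_less[OF lt(1)] next_step_ge[OF lt(1)]]
    show ?thesis
    proof (cases "C \<gamma> \<inter> {..<\<beta>} = {}")
      case True
      then show ?thesis
        using IH less.prems(2) below step by (simp add: lower_trace_step lt)
    next
      case ne: False
      let ?m = "Max (C \<gamma> \<inter> {..<\<beta>})"
      have m: "?m < \<eta>" if "\<eta> \<in> lower_trace \<alpha> \<beta>" for \<eta>
        using less.prems(2)[OF _ that] lower_trace_step_Max[OF lt(1) ne] by blast
      have "\<xi> < \<eta>" if "\<xi> \<in> lower_trace \<beta> (next_step \<beta> \<gamma>)" "\<eta> \<in> lower_trace \<alpha> \<beta>" for \<xi> \<eta>
        using less.prems(2)[of \<xi> \<eta>] lower_trace_step_Max[OF lt(1) ne] m[OF that(2)] that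
        by (cases "\<xi> < ?m") auto
      from IH[OF this] have "lower_trace \<alpha> (next_step \<beta> \<gamma>)
        = lower_trace \<beta> (next_step \<beta> \<gamma>) \<union> lower_trace \<alpha> \<beta>"
        by blast
      moreover have "lower_trace \<alpha> \<beta> - {..<?m} = lower_trace \<alpha> \<beta>"
        using m by fastforce
      ultimately show ?thesis
        using lower_trace_step_Max[OF lt(1) ne] lower_trace_step_Max[OF lt(2)] below ne step
        by (simp add: Un_Diff)
    qed
  qed
qed

text \<open>The first step of the walk already puts \<open>max(C\<^sub>\<delta> \<inter> \<xi>)\<close> into the trace and erases everything
  below it, and this maximum tends to \<open>\<delta>\<close> because \<open>C\<^sub>\<delta>\<close> is cofinal.\<close>

lemma lower_trace_tends_to_limit:
  assumes \<delta>: "limit_ordinal \<delta>" and "\<eta> < \<delta>"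
  obtains \<xi>\<^sub>0 where "\<xi>\<^sub>0 < \<delta>"
    and "\<And>\<xi>. \<xi>\<^sub>0 \<le> \<xi> \<Longrightarrow> \<xi> < \<delta> \<Longrightarrow> lower_trace \<xi> \<delta> \<noteq> {} \<and> lower_trace \<xi> \<delta> \<subseteq> {\<eta>..}"
proof -
  obtain c where c: "c \<in> C \<delta>" "\<eta> \<le> c"
    using C_cofinal[OF assms(2)] by blast
  then have "c < \<delta>"
    using C_subset by blast
  then obtain \<xi>\<^sub>0 where \<xi>\<^sub>0: "c < \<xi>\<^sub>0" "\<xi>\<^sub>0 < \<delta>"
    using limit_ordinal_dense[OF \<delta>] by blast
  show ?thesis
  proof
    show "\<xi>\<^sub>0 < \<delta>"
      by fact
    fix \<xi>
    assume \<xi>: "\<xi>\<^sub>0 \<le> \<xi>" "\<xi> < \<delta>"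
    then have c': "c \<in> C \<delta> \<inter> {..<\<xi>}"
      using c \<xi>\<^sub>0 by simp
    then have "c \<le> Max (C \<delta> \<inter> {..<\<xi>})"
      using Max_ge[OF finite_C_below[OF \<xi>(2)]] by blast
    then show "lower_trace \<xi> \<delta> \<noteq> {} \<and> lower_trace \<xi> \<delta> \<subseteq> {\<eta>..}"
      using lower_trace_step_Max[OF \<xi>(2)] c' c(2) by fastforce
  qed
qed

section \<open>The functions \<open>e\<^sub>\<beta>\<close>\<close>

lemma finite_upper_trace: "finite (upper_trace \<alpha> \<beta>)"
proof (induction \<beta> rule: less_induct)
  case (less \<beta>)
  show ?case
    using less[OF next_step_less] by (subst upper_trace.simps) auto
qed

lemma upper_trace_step: "\<alpha> < \<beta> \<Longrightarrow> upper_trace \<alpha> \<beta> = insert \<beta> (upper_trace \<alpha> (next_step \<alpha> \<beta>))"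
  by (subst upper_trace.simps) auto

lemma upper_trace_nonempty: "\<alpha> < \<beta> \<Longrightarrow> upper_trace \<alpha> \<beta> \<noteq> {}"
  by (simp add: upper_trace_step)

text \<open>If \<open>next_step \<alpha> \<beta> = \<alpha>\<close>, the remaining upper trace is empty and \<open>e\<close> of it is a maximum over the
  empty set; the recursion is therefore confined to walks with at least two steps.\<close>

lemma e_step:
  assumes "\<alpha> < next_step \<alpha> \<beta>" "\<alpha> < \<beta>"
  shows "e \<beta> \<alpha> = max (card (C \<beta> \<inter> {..<\<alpha>})) (e (next_step \<alpha> \<beta>) \<alpha>)"
  unfolding e_def upper_trace_step[OF assms(2)]
  using upper_trace_nonempty[OF assms(1)] finite_upper_trace by simp

lemma e_ge_card:
  assumes "\<alpha> < \<beta>"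
  shows "card (C \<beta> \<inter> {..<\<alpha>}) \<le> e \<beta> \<alpha>"
  unfolding e_def upper_trace_step[OF assms] using finite_upper_trace by (intro Max_ge) auto

lemma finite_few_predecessors:
  fixes A :: "'b::wellorder set"
  assumes fin: "\<And>x. x \<in> A \<Longrightarrow> finite (A \<inter> {..<x})"
  shows "finite {x \<in> A. card (A \<inter> {..<x}) \<le> n}"
proof -
  have "inj_on (\<lambda>x. card (A \<inter> {..<x})) A"
  proof (rule linorder_inj_onI)
    fix x y
    assume "x < y" "x \<in> A" "y \<in> A"
    then have "A \<inter> {..<x} \<subset> A \<inter> {..<y}"
      by (auto simp: psubset_eq)
    then show "card (A \<inter> {..<x}) \<noteq> card (A \<inter> {..<y})"
      using fin[OF \<open>y \<in> A\<close>] by (metis nat_neq_iff psubset_card_mono)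
  qed auto
  then have "inj_on (\<lambda>x. card (A \<inter> {..<x})) {x \<in> A. card (A \<inter> {..<x}) \<le> n}"
    by (rule inj_on_subset) auto
  then show ?thesis
    by (rule inj_on_finite[where B = "{..n}"]) auto
qed

lemma finite_C_few: "finite {c \<in> C \<beta>. card (C \<beta> \<inter> {..<c}) \<le> n}"
  using finite_few_predecessors[of "C \<beta>" n] finite_C_below C_subset by blast

text \<open>If \<open>e\<^sub>\<beta>(\<alpha>) \<le> n\<close>, then \<open>C\<^sub>\<beta>\<close> has at most \<open>n\<close> elements below the next step, so the next step is one of
  finitely many elements of \<open>C\<^sub>\<beta>\<close>, and induction applies to each of them.\<close>

lemma e_finite_to_one: "finite {\<alpha>. \<alpha> < \<beta> \<and> e \<beta> \<alpha> \<le> n}"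
proof (induction \<beta> rule: less_induct)
  case (less \<beta>)
  let ?P = "{c \<in> C \<beta>. card (C \<beta> \<inter> {..<c}) \<le> n}"
  have "{\<alpha>. \<alpha> < \<beta> \<and> e \<beta> \<alpha> \<le> n} \<subseteq> (\<Union>c\<in>?P. insert c {\<alpha>. \<alpha> < c \<and> e c \<alpha> \<le> n})"
  proof
    fix \<alpha>
    assume "\<alpha> \<in> {\<alpha>. \<alpha> < \<beta> \<and> e \<beta> \<alpha> \<le> n}"
    then have \<alpha>: "\<alpha> < \<beta>" "e \<beta> \<alpha> \<le> n"
      by auto
    let ?c = "next_step \<alpha> \<beta>"
    have "?c \<in> ?P"
      using e_ge_card[OF \<alpha>(1)] C_below_next_step[OF \<alpha>(1)] next_step_mem[OF \<alpha>(1)] \<alpha>(2) by simp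
    moreover have "\<alpha> \<in> insert ?c {\<alpha>. \<alpha> < ?c \<and> e ?c \<alpha> \<le> n}"
      using e_step[of \<alpha> \<beta>] \<alpha> next_step_ge[OF \<alpha>(1)] by auto
    ultimately show "\<alpha> \<in> (\<Union>c\<in>?P. insert c {\<alpha>. \<alpha> < c \<and> e c \<alpha> \<le> n})"
      by blast
  qed
  moreover have "finite \<dots>"
    using finite_C_few less C_subset by (intro finite_UN_I) (auto simp: subset_iff)
  ultimately show ?case
    by (rule finite_subset)
qed

text \<open>Cut \<open>\<alpha>\<close> into the finitely many intervals on which the first step \<open>c\<close> from \<open>\<beta>\<close> is constant. On
  such an interval \<open>e\<^sub>\<beta>\<close> is the maximum of \<open>e\<^sub>c\<close> and the constant \<open>|C\<^sub>\<beta> \<inter> c|\<close>, which differs from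
  \<open>e\<^sub>c\<close> only finitely often as \<open>e\<^sub>c\<close> is finite-to-one, and \<open>e\<^sub>c\<close> is coherent with \<open>e\<^sub>\<alpha>\<close> by
  induction.\<close>

lemma e_coherent: "\<alpha> \<le> \<beta> \<Longrightarrow> finite {\<zeta>. \<zeta> < \<alpha> \<and> e \<alpha> \<zeta> \<noteq> e \<beta> \<zeta>}"
proof (induction \<beta> arbitrary: \<alpha> rule: less_induct)
  case (less \<beta>)
  show ?case
  proof (cases "\<alpha> = \<beta>")
    case False
    then have lt: "\<alpha> < \<beta>"
      using less.prems by simp
    \<comment> \<open>Where they differ, \<open>e\<^sub>c\<close> is at most the constant \<open>|C\<^sub>\<beta> \<inter> c|\<close>.\<close>
    have near: "finite {\<zeta>. \<zeta> < c \<and> next_step \<zeta> \<beta> = c \<and> e \<beta> \<zeta> \<noteq> e c \<zeta>}" if "c < \<beta>" for c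
    proof (rule finite_subset[OF _ e_finite_to_one[of c "card (C \<beta> \<inter> {..<c})"]])
      show "{\<zeta>. \<zeta> < c \<and> next_step \<zeta> \<beta> = c \<and> e \<beta> \<zeta> \<noteq> e c \<zeta>}
        \<subseteq> {\<zeta>. \<zeta> < c \<and> e c \<zeta> \<le> card (C \<beta> \<inter> {..<c})}"
        using e_step C_below_next_step that by (fastforce simp: max_def)
    qed
    have far: "finite {\<zeta>. \<zeta> < c \<and> \<zeta> < \<alpha> \<and> e c \<zeta> \<noteq> e \<alpha> \<zeta>}" if "c < \<beta>" for c
    proof (cases "c \<le> \<alpha>")
      case True
      then show ?thesis
        by (rule_tac finite_subset[OF _ less.IH[OF lt True]]) auto
    next
      case False
      then show ?thesis
        by (rule_tac finite_subset[OF _ less.IH[OF that, of \<alpha>]]) auto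
    qed
    let ?c = "next_step \<alpha> \<beta>"
    let ?K = "insert ?c (C \<beta> \<inter> {..<\<alpha>})"
    have "{\<zeta>. \<zeta> < \<alpha> \<and> e \<alpha> \<zeta> \<noteq> e \<beta> \<zeta>} \<subseteq> (\<Union>c\<in>?K. insert c
      ({\<zeta>. \<zeta> < c \<and> next_step \<zeta> \<beta> = c \<and> e \<beta> \<zeta> \<noteq> e c \<zeta>} \<union> {\<zeta>. \<zeta> < c \<and> \<zeta> < \<alpha> \<and> e c \<zeta> \<noteq> e \<alpha> \<zeta>}))"
    proof
      fix \<zeta>
      assume \<zeta>: "\<zeta> \<in> {\<zeta>. \<zeta> < \<alpha> \<and> e \<alpha> \<zeta> \<noteq> e \<beta> \<zeta>}"
      then have "\<zeta> < \<beta>"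
        using lt by auto
      have mem: "next_step \<zeta> \<beta> \<in> C \<beta>" "\<zeta> \<le> next_step \<zeta> \<beta>"
        using next_step_mem[OF \<open>\<zeta> < \<beta>\<close>] by auto
      have "next_step \<zeta> \<beta> \<in> ?K"
      proof (cases "next_step \<zeta> \<beta> < \<alpha>")
        case False
        then have "next_step \<alpha> \<beta> \<le> next_step \<zeta> \<beta>"
          using next_step_le mem(1) by simp
        moreover have "next_step \<zeta> \<beta> \<le> next_step \<alpha> \<beta>"
          using next_step_le[of "next_step \<alpha> \<beta>" \<beta> \<zeta>] next_step_mem[OF lt] \<zeta> by auto
        ultimately show ?thesis
          by simp
      qed (use mem in auto)
      then show "\<zeta> \<in> (\<Union>c\<in>?K. insert c
      ({\<zeta>. \<zeta> < c \<and> next_step \<zeta> \<beta> = c \<and> e \<beta> \<zeta> \<noteq> e c \<zeta>} \<union> {\<zeta>. \<zeta> < c \<and> \<zeta> < \<alpha> \<and> e c \<zeta> \<noteq> e \<alpha> \<zeta>}))"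
        using mem(2) \<zeta> by (intro UN_I[of "next_step \<zeta> \<beta>"]) auto
    qed
    moreover have "finite \<dots>"
      using near far finite_C_below[OF lt] next_step_less[OF lt] lt by auto
    ultimately show ?thesis
      by (rule finite_subset)
  qed simp
qed

end

section \<open>Counting oscillations along concatenations\<close>

lemma Max_concat:
  fixes L M :: "'a::linorder set"
  assumes "finite L" "finite M" "M \<noteq> {}" "\<And>\<xi> \<eta>. \<xi> \<in> L \<Longrightarrow> \<eta> \<in> M \<Longrightarrow> \<xi> < \<eta>"
  shows "Max (L \<union> M) = Max M"
proof (cases "L = {}")
  case False
  then have "Max L < Max M"
    using assms by simp
  then show ?thesis
    using assms False by (subst Max_Un) (simp_all del: Max_gr_iff Max_less_iff Max_le_iff Max_ge_iff)
qed simp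

text \<open>The oscillation between two arbitrary functions along an arbitrary set, so that the traces and
  the functions \<open>e\<^sub>\<alpha>\<close>, \<open>e\<^sub>\<beta>\<close> can be modified separately.\<close>

definition osc_points :: "('a::linorder \<Rightarrow> nat) \<Rightarrow> ('a \<Rightarrow> nat) \<Rightarrow> 'a set \<Rightarrow> 'a set"
  where "osc_points f g L = {\<zeta> \<in> L - {Min L}.
    let \<zeta>' = Max {\<eta> \<in> L. \<eta> < \<zeta>} in f \<zeta>' \<le> g \<zeta>' \<and> f \<zeta> > g \<zeta>}"

definition osc_count :: "('a::linorder \<Rightarrow> nat) \<Rightarrow> ('a \<Rightarrow> nat) \<Rightarrow> 'a set \<Rightarrow> nat"
  where "osc_count f g L = card (osc_points f g L)"

lemma (in C_sequence) osc_eq_osc_count: "osc \<alpha> \<beta> = osc_count (e \<alpha>) (e \<beta>) (lower_trace \<alpha> \<beta>)"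
  by (simp add: osc_def osc_count_def osc_points_def)

lemma finite_below_nonempty:
  fixes L :: "'a::linorder set"
  assumes "finite L" "\<zeta> \<in> L - {Min L}"
  shows "finite {\<eta> \<in> L. \<eta> < \<zeta>}" "{\<eta> \<in> L. \<eta> < \<zeta>} \<noteq> {}"
proof -
  have "Min L \<in> L" "Min L < \<zeta>"
    using assms Min_in[of L] Min_le[of L \<zeta>] by (force simp: less_le)+
  then show "{\<eta> \<in> L. \<eta> < \<zeta>} \<noteq> {}"
    by blast
qed (use assms in simp)

lemma osc_count_cong:
  assumes "finite L" "\<And>\<zeta>. \<zeta> \<in> L \<Longrightarrow> f \<zeta> = f' \<zeta>" "\<And>\<zeta>. \<zeta> \<in> L \<Longrightarrow> g \<zeta> = g' \<zeta>"
  shows "osc_count f g L = osc_count f' g' L"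
proof -
  have "Max {\<eta> \<in> L. \<eta> < \<zeta>} \<in> L" if "\<zeta> \<in> L - {Min L}" for \<zeta>
    using Max_in[OF finite_below_nonempty[OF assms(1) that]] by simp
  then have "osc_points f g L = osc_points f' g' L"
    unfolding osc_points_def using assms(2,3) by (auto simp: Let_def)
  then show ?thesis
    by (simp add: osc_count_def)
qed

text \<open>Predecessors inside a block do not see the other block; the only new comparison is made between
  the last point of the lower block and the first point of the upper one.\<close>

lemma osc_points_concat:
  assumes fin: "finite L" "finite M" and ne: "L \<noteq> {}" "M \<noteq> {}"
    and less: "\<And>\<xi> \<eta>. \<xi> \<in> L \<Longrightarrow> \<eta> \<in> M \<Longrightarrow> \<xi> < \<eta>"
  shows "osc_points f g (L \<union> M) = osc_points f g L \<union> osc_points f g M \<union>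
    (if f (Max L) \<le> g (Max L) \<and> f (Min M) > g (Min M) then {Min M} else {})"
proof -
  have "Min L < Min M"
    using less fin ne by simp
  then have MinL: "Min (L \<union> M) = Min L"
    using fin ne by (subst Min_Un) (simp_all del: Min_gr_iff Min_less_iff Min_le_iff Min_ge_iff)
  have below_L: "{\<eta> \<in> L \<union> M. \<eta> < \<zeta>} = {\<eta> \<in> L. \<eta> < \<zeta>}" if "\<zeta> \<in> L" for \<zeta>
    using less[OF that] by (auto dest: less_asym)
  have below_M: "Max {\<eta> \<in> L \<union> M. \<eta> < \<zeta>} = Max {\<eta> \<in> M. \<eta> < \<zeta>}" if \<zeta>: "\<zeta> \<in> M" "\<zeta> \<noteq> Min M" for \<zeta>
  proof -
    have N: "{\<eta> \<in> M. \<eta> < \<zeta>} \<noteq> {}" "finite {\<eta> \<in> M. \<eta> < \<zeta>}"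
      using finite_below_nonempty[of M \<zeta>] \<zeta> fin by auto
    have "{\<eta> \<in> L \<union> M. \<eta> < \<zeta>} = L \<union> {\<eta> \<in> M. \<eta> < \<zeta>}"
      using less \<zeta> by auto
    then show ?thesis
      using Max_concat[OF fin(1) N(2,1)] less by simp
  qed
  have below_Min_M: "{\<eta> \<in> L \<union> M. \<eta> < Min M} = L"
    using less[OF _ Min_in[OF fin(2) ne(2)]] Min_le[OF fin(2)] by (auto simp: not_le[symmetric])
  have notL: "\<zeta> \<noteq> Min L" if "\<zeta> \<in> M" for \<zeta>
    using less[OF Min_in[OF fin(1) ne(1)] that] by blast
  have "\<zeta> \<in> osc_points f g (L \<union> M) \<longleftrightarrow> \<zeta> \<in> osc_points f g L \<union> osc_points f g M \<union>
    (if f (Max L) \<le> g (Max L) \<and> f (Min M) > g (Min M) then {Min M} else {})" for \<zeta>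
  proof -
    consider "\<zeta> \<in> L" | "\<zeta> \<in> M" "\<zeta> \<noteq> Min M" | "\<zeta> = Min M" | "\<zeta> \<notin> L \<union> M"
      by blast
    then show ?thesis
    proof cases
      case 1
      then have "\<zeta> \<notin> M"
        using less by blast
      then show ?thesis
        using 1 below_L[OF 1] Min_in[OF fin(2) ne(2)]
        by (auto simp: osc_points_def MinL)
    next
      case 2
      then have "\<zeta> \<notin> L"
        using less by blast
      then show ?thesis
        using 2 below_M[OF 2] notL[OF 2(1)] by (simp add: osc_points_def MinL)
    next
      case 3
      then have "\<zeta> \<in> M" "\<zeta> \<notin> L"
        using Min_in[OF fin(2) ne(2)] less by blast+
      then show ?thesis
        using 3 below_Min_M notL by (simp add: osc_points_def MinL Let_def)
    next
      case 4
      then show ?thesis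
        using Min_in[OF fin(2) ne(2)] by (auto simp: osc_points_def)
    qed
  qed
  then show ?thesis
    by blast
qed

lemma osc_count_concat:
  assumes fin: "finite L" "finite M" and ne: "L \<noteq> {}" "M \<noteq> {}"
    and less: "\<And>\<xi> \<eta>. \<xi> \<in> L \<Longrightarrow> \<eta> \<in> M \<Longrightarrow> \<xi> < \<eta>"
  shows "osc_count f g (L \<union> M) = osc_count f g L + osc_count f g M +
    (if f (Max L) \<le> g (Max L) \<and> f (Min M) > g (Min M) then 1 else 0)"
proof -
  let ?J = "if f (Max L) \<le> g (Max L) \<and> f (Min M) > g (Min M) then {Min M} else {}"
  have sub: "osc_points f g L \<subseteq> L" "osc_points f g M \<subseteq> M - {Min M}"
    by (auto simp: osc_points_def)
  then have finp: "finite (osc_points f g L)" "finite (osc_points f g M)"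
    using fin by (auto intro: finite_subset)
  have "osc_points f g L \<inter> osc_points f g M = {}"
    using sub less by blast
  moreover have "Min M \<notin> L"
    using less[OF _ Min_in[OF fin(2) ne(2)]] by blast
  then have "(osc_points f g L \<union> osc_points f g M) \<inter> ?J = {}"
    using sub by auto
  ultimately show ?thesis
    unfolding osc_count_def osc_points_concat[OF fin ne less, simplified]
    using finp by (subst card_Un_disjoint) (auto simp: card_Un_disjoint)
qed

lemma osc_count_eq_0:
  assumes "finite L" "(\<forall>\<zeta>\<in>L. f \<zeta> \<le> g \<zeta>) \<or> (\<forall>\<zeta>\<in>L. g \<zeta> < f \<zeta>)"
  shows "osc_count f g L = 0"
proof -
  have "Max {\<eta> \<in> L. \<eta> < \<zeta>} \<in> L" if "\<zeta> \<in> L - {Min L}" for \<zeta>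
    using Max_in[OF finite_below_nonempty[OF assms(1) that]] by simp
  then have "osc_points f g L = {}"
    using assms(2) by (fastforce simp: osc_points_def Let_def not_less)
  then show ?thesis
    by (simp add: osc_count_def)
qed

lemma osc_count_concat_eq:
  assumes "finite L" "finite M" "L \<noteq> {}" "M \<noteq> {}" "\<And>\<xi> \<eta>. \<xi> \<in> L \<Longrightarrow> \<eta> \<in> M \<Longrightarrow> \<xi> < \<eta>"
    and "\<And>\<zeta>. \<zeta> \<in> M \<Longrightarrow> f \<zeta> = g \<zeta>"
  shows "osc_count f g (L \<union> M) = osc_count f g L"
  using osc_count_concat[OF assms(1-5)] osc_count_eq_0[of M f g] assms(2,4,6) by simp

text \<open>Inside a block where \<open>f > g\<close> throughout, no point has a predecessor with \<open>f \<le> g\<close>; the one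
  oscillation happens at the entry into the block.\<close>

lemma osc_count_concat_greater:
  assumes "finite L" "finite M" "L \<noteq> {}" "M \<noteq> {}" "\<And>\<xi> \<eta>. \<xi> \<in> L \<Longrightarrow> \<eta> \<in> M \<Longrightarrow> \<xi> < \<eta>"
    and "\<And>\<zeta>. \<zeta> \<in> M \<Longrightarrow> g \<zeta> < f \<zeta>" and "f (Max L) \<le> g (Max L)"
  shows "osc_count f g (L \<union> M) = Suc (osc_count f g L)"
  using osc_count_concat[OF assms(1-5)] osc_count_eq_0[of M f g] assms(2,4,6,7) by simp

section \<open>Moore's oscillation theorem\<close>

text \<open>Restrictions are extended by the value \<open>0\<close>, so that the restrictions to a finite set form a
  countable set of total functions.\<close>

definition restr :: "'b set \<Rightarrow> ('b \<Rightarrow> nat) \<Rightarrow> 'b \<Rightarrow> nat"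
  where "restr F h = (\<lambda>\<zeta>. if \<zeta> \<in> F then h \<zeta> else 0)"

definition supported :: "'b set \<Rightarrow> ('b \<Rightarrow> nat) set"
  where "supported F = {h. \<forall>\<zeta>. \<zeta> \<notin> F \<longrightarrow> h \<zeta> = 0}"

lemma restr_supported: "restr F h \<in> supported F"
  by (simp add: restr_def supported_def)

lemma restr_eqD: "restr F h = restr F h' \<Longrightarrow> \<zeta> \<in> F \<Longrightarrow> h \<zeta> = h' \<zeta>"
  by (metis restr_def)

lemma countable_supported:
  fixes F :: "'b set"
  assumes "finite F"
  shows "countable (supported F)"
proof -
  have "supported F \<subseteq> restr F ` (F \<rightarrow>\<^sub>E UNIV)"
  proof
    fix h :: "'b \<Rightarrow> nat"
    assume "h \<in> supported F"
    then have "h = restr F (restrict h F)"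
      by (auto simp: supported_def restr_def)
    then show "h \<in> restr F ` (F \<rightarrow>\<^sub>E UNIV)"
      using image_eqI[of h "restr F" "restrict h F" "F \<rightarrow>\<^sub>E UNIV"] by simp
  qed
  moreover have "countable (restr F ` (F \<rightarrow>\<^sub>E (UNIV :: nat set)))"
    using assms by (intro countable_image countable_PiE) auto
  ultimately show ?thesis
    by (rule countable_subset)
qed

text \<open>An uncountable family of finite sets that move up, and an unbounded set of ordinals, both indexed
  by \<open>\<omega>\<^sub>1\<close>. Being above \<open>\<delta>\<close> then is a property of the index, which is what reflection acts on.\<close>

locale indexed_families = C_sequence C for C :: "'a::omega1 \<Rightarrow> 'a set" +
  fixes a :: "'a \<Rightarrow> 'a set" and b :: "'a \<Rightarrow> 'a"
  assumes finite_a: "finite (a \<gamma>)"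
    and a_ge: "\<alpha> \<in> a \<gamma> \<Longrightarrow> \<gamma> \<le> \<alpha>"
    and b_ge: "\<gamma> \<le> b \<gamma>"
begin

text \<open>Otherwise there are infinitely many pairwise disjoint finite sets \<open>M \<eta>\<close> such that, for every large
  \<open>\<gamma> \<in> K\<close>, some \<open>e\<^sub>\<alpha>\<close> with \<open>\<alpha> \<in> a \<gamma>\<close> takes a value at most \<open>n\<close> on each of them. For a single \<open>\<gamma>\<close>
  above all the thresholds this contradicts that finitely many functions, all finite-to-one,
  take small values at only finitely many places.\<close>

lemma e_large_on_finite_sets:
  assumes K: "unbounded K"
  shows "\<exists>\<eta>. \<forall>M \<xi>. finite M \<longrightarrow> M \<subseteq> {\<eta>..} \<longrightarrow>
    (\<exists>\<gamma>\<in>K. \<xi> \<le> \<gamma> \<and> (\<forall>\<alpha>\<in>a \<gamma>. \<forall>\<zeta>\<in>M. \<zeta> < \<alpha> \<longrightarrow> n < e \<alpha> \<zeta>))"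
proof (rule ccontr)
  assume "\<not> ?thesis"
  then have "\<forall>\<eta>. \<exists>M \<xi>. finite M \<and> M \<subseteq> {\<eta>..} \<and>
    (\<forall>\<gamma>\<in>K. \<xi> \<le> \<gamma> \<longrightarrow> (\<exists>\<alpha>\<in>a \<gamma>. \<exists>\<zeta>\<in>M. \<zeta> < \<alpha> \<and> e \<alpha> \<zeta> \<le> n))"
    by (simp add: not_less)
  then obtain M X where fin: "\<And>\<eta>. finite (M \<eta>)" and M: "\<And>\<eta>. M \<eta> \<subseteq> {\<eta>..}"
    and small: "\<And>\<eta> \<gamma>. \<gamma> \<in> K \<Longrightarrow> X \<eta> \<le> \<gamma> \<Longrightarrow> \<exists>\<alpha>\<in>a \<gamma>. \<exists>\<zeta>\<in>M \<eta>. \<zeta> < \<alpha> \<and> e \<alpha> \<zeta> \<le> n"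
    by metis
  have "\<exists>\<theta>. \<forall>\<zeta>\<in>insert \<eta> (M \<eta>). \<zeta> < \<theta>" for \<eta>
    using countable_imp_strictly_bounded[of "insert \<eta> (M \<eta>)"] fin
    by (metis countable_finite finite_insert)
  then obtain h where h: "\<And>\<eta> \<zeta>. \<zeta> \<in> M \<eta> \<Longrightarrow> \<zeta> < h \<eta>"
    by (metis insertCI)
  \<comment> \<open>Any starting point will do; the sets \<open>M (s j)\<close> are pairwise disjoint as \<open>M (s j)\<close> lies below \<open>s (j + 1)\<close>.\<close>
  define s where "s j = (h ^^ j) undefined" for j
  have "countable (range (\<lambda>j. X (s j)))"
    by simp
  then obtain \<xi> where \<xi>: "\<And>j. X (s j) < \<xi>"
    by (rule countable_imp_strictly_bounded) auto
  obtain \<gamma> where \<gamma>: "\<gamma> \<in> K" "\<xi> < \<gamma>"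
    using K by (auto simp: unbounded_def)
  have "X (s j) \<le> \<gamma>" for j
    using \<xi>[of j] \<gamma>(2) by (meson less_imp_le less_trans)
  then have "\<exists>\<alpha>\<in>a \<gamma>. \<exists>\<zeta>\<in>M (s j). \<zeta> < \<alpha> \<and> e \<alpha> \<zeta> \<le> n" for j
    using small[OF \<gamma>(1)] by blast
  then have "\<exists>\<zeta>. \<zeta> \<in> M (s j) \<and> (\<exists>\<alpha>\<in>a \<gamma>. \<zeta> < \<alpha> \<and> e \<alpha> \<zeta> \<le> n)" for j
    by blast
  then obtain \<zeta> where \<zeta>: "\<And>j. \<zeta> j \<in> M (s j)" "\<And>j. \<exists>\<alpha>\<in>a \<gamma>. \<zeta> j < \<alpha> \<and> e \<alpha> (\<zeta> j) \<le> n"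
    by metis
  have "\<zeta> j < \<zeta> (Suc j)" for j
  proof -
    have "s (Suc j) \<le> \<zeta> (Suc j)"
      using \<zeta>(1)[of "Suc j"] M by blast
    then show ?thesis
      using h[OF \<zeta>(1)[of j]] by (simp add: s_def)
  qed
  then have "inj \<zeta>"
    by (intro strict_mono_imp_inj_on) (simp add: strict_mono_Suc_iff)
  then have "infinite (range \<zeta>)"
    using range_inj_infinite by blast
  moreover have "range \<zeta> \<subseteq> (\<Union>\<alpha>\<in>a \<gamma>. {\<zeta>. \<zeta> < \<alpha> \<and> e \<alpha> \<zeta> \<le> n})"
    using \<zeta>(2) by blast
  moreover have "finite (\<Union>\<alpha>\<in>a \<gamma>. {\<zeta>. \<zeta> < \<alpha> \<and> e \<alpha> \<zeta> \<le> n})"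
    using finite_a e_finite_to_one by blast
  ultimately show False
    using finite_subset by blast
qed

definition large_from :: "'a set \<Rightarrow> 'a \<Rightarrow> bool"
  where "large_from K \<eta> \<longleftrightarrow> (\<forall>M n \<xi>. finite M \<longrightarrow> M \<subseteq> {\<eta>..} \<longrightarrow>
    (\<exists>\<gamma>\<in>K. \<xi> \<le> \<gamma> \<and> (\<forall>\<alpha>\<in>a \<gamma>. \<forall>\<zeta>\<in>M. \<zeta> < \<alpha> \<longrightarrow> n < e \<alpha> \<zeta>)))"

lemma large_from_exists:
  assumes K: "unbounded K"
  shows "\<exists>\<eta>. large_from K \<eta>"
proof -
  obtain h where h: "\<And>n M \<xi>. finite M \<Longrightarrow> M \<subseteq> {h n..} \<Longrightarrow>
    \<exists>\<gamma>\<in>K. \<xi> \<le> \<gamma> \<and> (\<forall>\<alpha>\<in>a \<gamma>. \<forall>\<zeta>\<in>M. \<zeta> < \<alpha> \<longrightarrow> n < e \<alpha> \<zeta>)"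
    using e_large_on_finite_sets[OF K] by metis
  have "countable (range h)"
    by simp
  then obtain \<eta> where \<eta>: "\<And>n. h n < \<eta>"
    by (rule countable_imp_strictly_bounded) auto
  have "M \<subseteq> {h n..}" if "M \<subseteq> {\<eta>..}" for M n
    using that \<eta>[of n] by fastforce
  then have "large_from K \<eta>"
    unfolding large_from_def by (intro allI impI) (rule h)
  then show ?thesis ..
qed

text \<open>The type of a pair of indices over \<open>\<delta>\<close> consists of \<open>F = L(\<delta>,b)\<close>, of the restrictions \<open>\<Phi>\<close> and
  \<open>g\<close> to \<open>F\<close> of the functions \<open>e\<^sub>\<alpha>\<close> and \<open>e\<^sub>b\<close>, and of an ordinal \<open>\<eta>\<close> above which these functions
  agree with \<open>e\<^sub>\<delta>\<close>. Only countably many types have their parameters below a given ordinal. Keeping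
  \<open>\<Phi>\<close> as a set, not as a tuple, avoids enumerating the finite sets \<open>a \<gamma>\<close>.\<close>

definition matching :: "'a set \<Rightarrow> ('a \<Rightarrow> nat) set \<Rightarrow> 'a set"
  where "matching F \<Phi> = {\<gamma>. \<forall>\<alpha>\<in>a \<gamma>. restr F (e \<alpha>) \<in> \<Phi>}"

definition realizing :: "'a set \<Rightarrow> ('a \<Rightarrow> nat) set \<Rightarrow> ('a \<Rightarrow> nat) \<Rightarrow> 'a \<Rightarrow> 'a set"
  where "realizing F \<Phi> g \<eta> = {\<delta>. \<exists>\<gamma>\<ge>\<delta>. \<exists>\<rho>\<ge>\<delta>. \<gamma> \<in> matching F \<Phi> \<and>
    restr F (e (b \<rho>)) = g \<and> lower_trace \<delta> (b \<rho>) = F \<and>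
    (\<forall>\<zeta>. \<eta> \<le> \<zeta> \<longrightarrow> \<zeta> < \<delta> \<longrightarrow> (\<forall>\<alpha>\<in>a \<gamma>. e \<alpha> \<zeta> = e \<delta> \<zeta>) \<and> e (b \<rho>) \<zeta> = e \<delta> \<zeta>)}"

definition trace_above :: "'a \<Rightarrow> 'a \<Rightarrow> 'a \<Rightarrow> bool"
  where "trace_above \<eta> \<xi> \<delta> \<longleftrightarrow> lower_trace \<xi> \<delta> \<noteq> {} \<and> lower_trace \<xi> \<delta> \<subseteq> {\<eta>..}"

text \<open>If \<open>\<delta>\<close> belongs to this set, no \<open>\<delta>' \<in> E\<close> can be used to prolong traces beyond \<open>\<eta>\<close>;
  reflection will exclude that.\<close>

definition unreached :: "'a set \<Rightarrow> 'a \<Rightarrow> 'a set"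
  where "unreached E \<eta> = {\<xi>. \<forall>\<delta>\<in>E. \<xi> < \<delta> \<longrightarrow> \<not> trace_above \<eta> \<xi> \<delta>}"

definition params :: "'a \<Rightarrow> ('a set \<times> ('a \<Rightarrow> nat) set \<times> ('a \<Rightarrow> nat)) set"
  where "params \<eta> = (SIGMA F : Fpow {..<\<eta>}. Fpow (supported F) \<times> supported F)"

text \<open>The singletons make \<open>\<delta>\<close> closed under \<open>\<gamma> \<mapsto> a \<gamma>\<close> and put the thresholds of \<open>large_from\<close> below \<open>\<delta>\<close>.\<close>

definition reflected_sets :: "'a \<Rightarrow> 'a set set"
  where "reflected_sets \<eta> = (\<lambda>x. {x}) ` a \<eta> \<union> (\<Union>(F, \<Phi>, g)\<in>params \<eta>.
    {matching F \<Phi>, {SOME \<eta>. large_from (matching F \<Phi>) \<eta>}, unreached (realizing F \<Phi> g \<eta>) \<eta>})"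

lemma countable_reflected_sets: "countable (reflected_sets \<eta>)"
proof -
  have "countable (params \<eta>)"
    unfolding params_def
  proof (rule countable_SIGMA)
    show "countable (Fpow {..<\<eta>})"
      by (rule countable_Fpow[OF countable_lessThan])
    fix F
    assume "F \<in> Fpow {..<\<eta>}"
    then have "countable (supported F)"
      by (intro countable_supported) (simp add: Fpow_def)
    then show "countable (Fpow (supported F) \<times> supported F)"
      by (intro countable_SIGMA countable_Fpow)
  qed
  then show ?thesis
    unfolding reflected_sets_def
    by (intro countable_Un countable_image countable_finite[OF finite_a] countable_UN) (auto split: prod.splits)
qed

lemma matching_restr_image:
  assumes "\<gamma>' \<in> matching F ((\<lambda>\<alpha>. restr F (e \<alpha>)) ` a \<gamma>)"
  shows "\<forall>\<alpha>'\<in>a \<gamma>'. \<exists>\<alpha>\<in>a \<gamma>. \<forall>\<zeta>\<in>F. e \<alpha>' \<zeta> = e \<alpha> \<zeta>"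
proof
  fix \<alpha>'
  assume "\<alpha>' \<in> a \<gamma>'"
  then obtain \<alpha> where "\<alpha> \<in> a \<gamma>" "restr F (e \<alpha>') = restr F (e \<alpha>)"
    using assms unfolding matching_def by blast
  then show "\<exists>\<alpha>\<in>a \<gamma>. \<forall>\<zeta>\<in>F. e \<alpha>' \<zeta> = e \<alpha> \<zeta>"
    using restr_eqD[of F "e \<alpha>'" "e \<alpha>"] by blast
qed

end

locale indexed_families_at = indexed_families C a b
  for C :: "'a::omega1 \<Rightarrow> 'a set" and a b +
  fixes \<delta> :: 'a
  assumes reflecting: "reflecting reflected_sets \<delta>"
begin

lemma limit_\<delta>: "limit_ordinal \<delta>"
  by (rule reflecting_limit[OF reflecting])

lemma finite_bounded_below_\<delta>:
  assumes "finite X" "X \<subseteq> {..<\<delta>}"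
  obtains \<eta> where "\<eta> < \<delta>" "X \<subseteq> {..<\<eta>}"
  using limit_ordinal_strictly_bounds_finite[OF limit_\<delta> assms] by (metis lessThan_iff subsetI)

lemma eventually_coherent:
  assumes "finite X" "\<And>\<beta>. \<beta> \<in> X \<Longrightarrow> \<delta> \<le> \<beta>"
  obtains \<eta> where "\<eta> < \<delta>" "\<And>\<beta> \<zeta>. \<beta> \<in> X \<Longrightarrow> \<eta> \<le> \<zeta> \<Longrightarrow> \<zeta> < \<delta> \<Longrightarrow> e \<beta> \<zeta> = e \<delta> \<zeta>"
proof -
  have "finite (\<Union>\<beta>\<in>X. {\<zeta>. \<zeta> < \<delta> \<and> e \<delta> \<zeta> \<noteq> e \<beta> \<zeta>})"
    using assms e_coherent by blast
  then obtain \<eta> where "\<eta> < \<delta>" "(\<Union>\<beta>\<in>X. {\<zeta>. \<zeta> < \<delta> \<and> e \<delta> \<zeta> \<noteq> e \<beta> \<zeta>}) \<subseteq> {..<\<eta>}"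
    by (rule finite_bounded_below_\<delta>) auto
  then show ?thesis
    by (intro that[of \<eta>]) fastforce+
qed

text \<open>The indices \<open>\<gamma>\<close>, \<open>\<rho>\<close> are replaced by \<open>\<gamma>'\<close>, \<open>\<rho>'\<close> so that nothing changes on the old trace
  \<open>L(\<delta>, b \<rho>)\<close>, the new trace continues it by a nonempty block \<open>M\<close>, and \<open>e\<^sub>b\<close> and \<open>e\<^sub>\<alpha>\<close> compare by
  \<open>R\<close> on all of \<open>M\<close>.\<close>

definition extends_by :: "(nat \<Rightarrow> nat \<Rightarrow> bool) \<Rightarrow> 'a \<Rightarrow> 'a \<Rightarrow> 'a \<Rightarrow> 'a \<Rightarrow> 'a set \<Rightarrow> bool"
  where "extends_by R \<gamma> \<rho> \<gamma>' \<rho>' M \<longleftrightarrow> \<delta> \<le> \<gamma>' \<and> \<delta> \<le> \<rho>' \<and>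
    (let L = lower_trace \<delta> (b \<rho>) in
      lower_trace \<delta> (b \<rho>') = L \<union> M \<and> finite M \<and> M \<noteq> {} \<and> (\<forall>\<xi>\<in>L. \<forall>\<eta>\<in>M. \<xi> < \<eta>) \<and>
      (\<forall>\<zeta>\<in>L. e (b \<rho>') \<zeta> = e (b \<rho>) \<zeta>) \<and> (\<forall>\<alpha>'\<in>a \<gamma>'. \<exists>\<alpha>\<in>a \<gamma>. \<forall>\<zeta>\<in>L. e \<alpha>' \<zeta> = e \<alpha> \<zeta>) \<and>
      (\<forall>\<alpha>\<in>a \<gamma>'. \<forall>\<zeta>\<in>M. R (e (b \<rho>') \<zeta>) (e \<alpha> \<zeta>)))"

lemma extends_byD:
  assumes "extends_by R \<gamma> \<rho> \<gamma>' \<rho>' M" and "L = lower_trace \<delta> (b \<rho>)"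
  shows "\<delta> \<le> \<gamma>'" "\<delta> \<le> \<rho>'" "lower_trace \<delta> (b \<rho>') = L \<union> M" "finite M" "M \<noteq> {}"
    "\<And>\<xi> \<eta>. \<xi> \<in> L \<Longrightarrow> \<eta> \<in> M \<Longrightarrow> \<xi> < \<eta>"
    "\<And>\<zeta>. \<zeta> \<in> L \<Longrightarrow> e (b \<rho>') \<zeta> = e (b \<rho>) \<zeta>"
    "\<And>\<alpha>'. \<alpha>' \<in> a \<gamma>' \<Longrightarrow> \<exists>\<alpha>\<in>a \<gamma>. \<forall>\<zeta>\<in>L. e \<alpha>' \<zeta> = e \<alpha> \<zeta>"
    "\<And>\<alpha> \<zeta>. \<alpha> \<in> a \<gamma>' \<Longrightarrow> \<zeta> \<in> M \<Longrightarrow> R (e (b \<rho>') \<zeta>) (e \<alpha> \<zeta>)"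
  using assms unfolding extends_by_def Let_def by auto

text \<open>Let \<open>E\<close> be the set of ordinals realizing the type of \<open>(\<gamma>,\<rho>)\<close>. For \<open>\<delta>' \<in> E\<close> above \<open>\<delta>\<close> with \<open>L(\<delta>,\<delta>')\<close>
  above the parameter \<open>\<eta>\<close>, the indices realizing the type at \<open>\<delta>'\<close> have \<open>L(\<delta>,b) = F \<union> L(\<delta>,\<delta>')\<close>, and on
  the new block their functions agree with \<open>e \<delta>'\<close>. Such a \<open>\<delta>'\<close> exists: otherwise \<open>\<delta>\<close> is in
  the corresponding set \<open>unreached E \<eta>\<close>, which then is cofinal in \<open>\<delta>\<close>; but \<open>\<delta> \<in> E\<close> itself and the
  traces \<open>L(\<xi>,\<delta>)\<close> tend to \<open>\<delta>\<close>, so \<open>\<delta>\<close> witnesses that ordinals \<open>\<xi>\<close> close to \<open>\<delta>\<close> are not in it.\<close>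

lemma step_equal:
  assumes \<gamma>: "\<delta> \<le> \<gamma>" and \<rho>: "\<delta> \<le> \<rho>" and \<eta>\<^sub>0: "\<eta>\<^sub>0 < \<delta>"
  obtains \<gamma>' \<rho>' M where "extends_by (=) \<gamma> \<rho> \<gamma>' \<rho>' M" "M \<subseteq> {\<eta>\<^sub>0..<\<delta>}"
proof -
  define L where "L = lower_trace \<delta> (b \<rho>)"
  define \<Phi> where "\<Phi> = (\<lambda>\<alpha>. restr L (e \<alpha>)) ` a \<gamma>"
  have L: "finite L" "L \<subseteq> {..<\<delta>}"
    unfolding L_def using finite_lower_trace lower_trace_subset by auto
  have "\<delta> \<le> \<beta>" if "\<beta> \<in> insert (b \<rho>) (a \<gamma>)" for \<beta>
    using that \<gamma> \<rho> a_ge[of \<beta> \<gamma>] b_ge[of \<rho>] by auto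
  then obtain \<eta>\<^sub>1 where \<eta>\<^sub>1: "\<eta>\<^sub>1 < \<delta>"
    "\<And>\<beta> \<zeta>. \<beta> \<in> insert (b \<rho>) (a \<gamma>) \<Longrightarrow> \<eta>\<^sub>1 \<le> \<zeta> \<Longrightarrow> \<zeta> < \<delta> \<Longrightarrow> e \<beta> \<zeta> = e \<delta> \<zeta>"
    using eventually_coherent[of "insert (b \<rho>) (a \<gamma>)"] finite_a[of \<gamma>] by blast
  obtain \<eta> where \<eta>: "\<eta> < \<delta>" "insert \<eta>\<^sub>0 (insert \<eta>\<^sub>1 L) \<subseteq> {..<\<eta>}"
    using finite_bounded_below_\<delta>[of "insert \<eta>\<^sub>0 (insert \<eta>\<^sub>1 L)"] L \<eta>\<^sub>0 \<eta>\<^sub>1(1) by auto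
  define g where "g = restr L (e (b \<rho>))"
  define E where "E = realizing L \<Phi> g \<eta>"
  have "\<gamma> \<in> matching L \<Phi>"
    by (simp add: matching_def \<Phi>_def)
  moreover have "e \<beta> \<zeta> = e \<delta> \<zeta>" if "\<beta> \<in> insert (b \<rho>) (a \<gamma>)" "\<eta> \<le> \<zeta>" "\<zeta> < \<delta>" for \<beta> \<zeta>
    using \<eta>\<^sub>1(2)[OF that(1) _ that(3)] that(2) \<eta>(2) by auto
  ultimately have \<delta>E: "\<delta> \<in> E"
    unfolding E_def realizing_def g_def L_def using \<gamma> \<rho> by blast
  have "(L, \<Phi>, g) \<in> params \<eta>"
    unfolding params_def \<Phi>_def g_def Fpow_def using L(1) \<eta>(2) finite_a restr_supported by auto
  then have P: "unreached E \<eta> \<in> reflected_sets \<eta>"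
    unfolding reflected_sets_def E_def by blast
  have "\<delta> \<notin> unreached E \<eta>"
  proof
    assume \<delta>: "\<delta> \<in> unreached E \<eta>"
    obtain \<xi>\<^sub>0 where \<xi>\<^sub>0: "\<xi>\<^sub>0 < \<delta>" "\<And>\<xi>. \<xi>\<^sub>0 \<le> \<xi> \<Longrightarrow> \<xi> < \<delta> \<Longrightarrow> trace_above \<eta> \<xi> \<delta>"
      unfolding trace_above_def using lower_trace_tends_to_limit[OF limit_\<delta> \<eta>(1)] by blast
    obtain \<xi> where "\<xi> \<in> unreached E \<eta>" "\<xi>\<^sub>0 < \<xi>" "\<xi> < \<delta>"
      using reflectingD(2)[OF reflecting \<eta>(1) P \<delta> order_refl \<xi>\<^sub>0(1)] by blast
    then show False
      using \<xi>\<^sub>0(2) \<delta>E by (auto simp: unreached_def)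
  qed
  then obtain \<delta>' where \<delta>': "\<delta>' \<in> E" "\<delta> < \<delta>'" "trace_above \<eta> \<delta> \<delta>'"
    by (auto simp: unreached_def)
  then obtain \<gamma>' \<rho>' where *: "\<delta>' \<le> \<gamma>'" "\<delta>' \<le> \<rho>'" "\<gamma>' \<in> matching L \<Phi>" "restr L (e (b \<rho>')) = g"
    "lower_trace \<delta>' (b \<rho>') = L"
    "\<And>\<zeta>. \<eta> \<le> \<zeta> \<Longrightarrow> \<zeta> < \<delta>' \<Longrightarrow> (\<forall>\<alpha>\<in>a \<gamma>'. e \<alpha> \<zeta> = e \<delta>' \<zeta>) \<and> e (b \<rho>') \<zeta> = e \<delta>' \<zeta>"
    unfolding E_def realizing_def by blast
  define M where "M = lower_trace \<delta> \<delta>'"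
  have M: "finite M" "M \<noteq> {}" "M \<subseteq> {\<eta>..}" "M \<subseteq> {..<\<delta>}"
    using \<delta>'(3) finite_lower_trace lower_trace_subset by (auto simp: trace_above_def M_def)
  have less: "\<xi> < \<zeta>" if "\<xi> \<in> L" "\<zeta> \<in> M" for \<xi> \<zeta>
    using that M(3) \<eta>(2) by fastforce
  show ?thesis
  proof (rule that[of \<gamma>' \<rho>' M])
    show "M \<subseteq> {\<eta>\<^sub>0..<\<delta>}"
      using M(3,4) \<eta>(2) by fastforce
    have "\<delta>' \<le> b \<rho>'"
      using *(2) b_ge[of \<rho>'] by simp
    then have "lower_trace \<delta> (b \<rho>') = L \<union> M"
      unfolding M_def using less M(2) \<delta>'(2)
      by (subst lower_trace_concat[of \<delta> \<delta>']) (simp_all add: *(5) M_def)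
    moreover have "\<forall>\<zeta>\<in>L. e (b \<rho>') \<zeta> = e (b \<rho>) \<zeta>"
      using restr_eqD[OF *(4)[unfolded g_def]] by simp
    moreover have "\<forall>\<alpha>'\<in>a \<gamma>'. \<exists>\<alpha>\<in>a \<gamma>. \<forall>\<zeta>\<in>L. e \<alpha>' \<zeta> = e \<alpha> \<zeta>"
      by (rule matching_restr_image[OF *(3)[unfolded \<Phi>_def]])
    moreover have "e (b \<rho>') \<zeta> = e \<alpha> \<zeta>" if "\<alpha> \<in> a \<gamma>'" "\<zeta> \<in> M" for \<alpha> \<zeta>
    proof -
      have "\<eta> \<le> \<zeta>" "\<zeta> < \<delta>'"
        using that(2) M(3,4) \<delta>'(2) by (auto intro: less_trans)
      then show ?thesis
        using *(6) that(1) by simp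
    qed
    moreover have "\<delta> \<le> \<gamma>'" "\<delta> \<le> \<rho>'"
      using \<delta>'(2) *(1,2) by auto
    ultimately show "extends_by (=) \<gamma> \<rho> \<gamma>' \<rho>' M"
      unfolding extends_by_def L_def[symmetric] Let_def using M(1,2) less by blast
  qed
qed

text \<open>Obtain \<open>\<rho>'\<close> and the block \<open>M\<close> from \<open>step_equal\<close>, with \<open>M\<close> above the threshold of \<open>large_from\<close>.
  As the values of \<open>e\<^sub>b\<close> on \<open>M\<close> are then fixed, \<open>\<gamma>'\<close> can be chosen afterwards with larger
  values on \<open>M\<close>.\<close>

lemma step_greater:
  assumes \<gamma>: "\<delta> \<le> \<gamma>" and \<rho>: "\<delta> \<le> \<rho>"
  obtains \<gamma>' \<rho>' M where "extends_by (<) \<gamma> \<rho> \<gamma>' \<rho>' M"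
proof -
  define L where "L = lower_trace \<delta> (b \<rho>)"
  define \<Phi> where "\<Phi> = (\<lambda>\<alpha>. restr L (e \<alpha>)) ` a \<gamma>"
  have L: "finite L" "L \<subseteq> {..<\<delta>}"
    unfolding L_def using finite_lower_trace lower_trace_subset by auto
  obtain \<eta>\<^sub>1 where \<eta>\<^sub>1: "\<eta>\<^sub>1 < \<delta>" "L \<subseteq> {..<\<eta>\<^sub>1}"
    using finite_bounded_below_\<delta>[OF L] by blast
  define \<eta>\<^sub>0 where "\<eta>\<^sub>0 = (SOME \<eta>. large_from (matching L \<Phi>) \<eta>)"
  have "(L, \<Phi>, restr L undefined) \<in> params \<eta>\<^sub>1"
    unfolding params_def \<Phi>_def Fpow_def using L(1) \<eta>\<^sub>1(2) finite_a restr_supported by auto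
  then have P: "matching L \<Phi> \<in> reflected_sets \<eta>\<^sub>1" "{\<eta>\<^sub>0} \<in> reflected_sets \<eta>\<^sub>1"
    unfolding reflected_sets_def \<eta>\<^sub>0_def by blast+
  have "\<gamma> \<in> matching L \<Phi>"
    by (simp add: matching_def \<Phi>_def)
  then have "unbounded (matching L \<Phi>)"
    using reflectingD(1)[OF reflecting \<eta>\<^sub>1(1) P(1)] \<gamma> by blast
  then have large: "large_from (matching L \<Phi>) \<eta>\<^sub>0"
    unfolding \<eta>\<^sub>0_def by (rule someI_ex[OF large_from_exists])
  have "\<eta>\<^sub>0 < \<delta>"
    by (rule reflecting_singleton[OF reflecting \<eta>\<^sub>1(1) P(2)])
  then obtain \<gamma>\<^sub>1 \<rho>' M
    where ext: "extends_by (=) \<gamma> \<rho> \<gamma>\<^sub>1 \<rho>' M" and M: "M \<subseteq> {\<eta>\<^sub>0..<\<delta>}"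
    by (rule step_equal[OF \<gamma> \<rho>])
  note * = extends_byD[OF ext L_def]
  have "M \<subseteq> {\<eta>\<^sub>0..}"
    using M by auto
  then obtain \<gamma>' where \<gamma>': "\<gamma>' \<in> matching L \<Phi>" "\<delta> \<le> \<gamma>'"
    "\<And>\<alpha> \<zeta>. \<alpha> \<in> a \<gamma>' \<Longrightarrow> \<zeta> \<in> M \<Longrightarrow> \<zeta> < \<alpha> \<Longrightarrow> Max (e (b \<rho>') ` M) < e \<alpha> \<zeta>"
    using large[unfolded large_from_def, rule_format, OF *(4), of \<delta> "Max (e (b \<rho>') ` M)"] by blast
  have "e (b \<rho>') \<zeta> < e \<alpha> \<zeta>" if "\<alpha> \<in> a \<gamma>'" "\<zeta> \<in> M" for \<alpha> \<zeta>
  proof -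
    have "\<zeta> < \<alpha>"
      using that M \<gamma>'(2) a_ge[OF that(1)] by fastforce
    from \<gamma>'(3)[OF that this] show ?thesis
      using Max_ge[of "e (b \<rho>') ` M" "e (b \<rho>') \<zeta>"] *(4) that(2) by (simp del: Max_ge Max_less_iff)
  qed
  moreover have "\<forall>\<alpha>'\<in>a \<gamma>'. \<exists>\<alpha>\<in>a \<gamma>. \<forall>\<zeta>\<in>L. e \<alpha>' \<zeta> = e \<alpha> \<zeta>"
    by (rule matching_restr_image[OF \<gamma>'(1)[unfolded \<Phi>_def]])
  ultimately have "extends_by (<) \<gamma> \<rho> \<gamma>' \<rho>' M"
    unfolding extends_by_def L_def[symmetric] Let_def using *(2-7) \<gamma>'(2) by blast
  then show ?thesis
    by (rule that)
qed

text \<open>An equal block followed by a greater block adds one oscillation: the equal block adds none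
  and makes the last comparison \<open>\<le>\<close>, so the entry into the greater block counts.\<close>

lemma double_step:
  assumes \<gamma>: "\<delta> \<le> \<gamma>" and \<rho>: "\<delta> \<le> \<rho>"
  defines "L \<equiv> lower_trace \<delta> (b \<rho>)"
  assumes ne: "L \<noteq> {}" and last: "\<And>\<alpha>. \<alpha> \<in> a \<gamma> \<Longrightarrow> e (b \<rho>) (Max L) < e \<alpha> (Max L)"
  obtains \<gamma>' \<rho>' L' where "\<delta> \<le> \<gamma>'" "\<delta> \<le> \<rho>'" "lower_trace \<delta> (b \<rho>') = L'" "L \<subseteq> L'"
    "\<And>\<alpha>'. \<alpha>' \<in> a \<gamma>' \<Longrightarrow> e (b \<rho>') (Max L') < e \<alpha>' (Max L')"
    "\<And>\<alpha>'. \<alpha>' \<in> a \<gamma>' \<Longrightarrow> \<exists>\<alpha>\<in>a \<gamma>. (\<forall>\<zeta>\<in>L. e \<alpha>' \<zeta> = e \<alpha> \<zeta>) \<and>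
      osc_count (e \<alpha>') (e (b \<rho>')) L' = Suc (osc_count (e \<alpha>) (e (b \<rho>)) L)"
proof -
  have finL: "finite L"
    unfolding L_def by (rule finite_lower_trace)
  have "\<exists>\<eta>\<^sub>0. \<eta>\<^sub>0 < \<delta>"
    using limit_\<delta> by (auto simp: limit_ordinal_def)
  then obtain \<eta>\<^sub>0 where "\<eta>\<^sub>0 < \<delta>" ..
  obtain \<gamma>\<^sub>1 \<rho>\<^sub>1 M where ext1: "extends_by (=) \<gamma> \<rho> \<gamma>\<^sub>1 \<rho>\<^sub>1 M" and "M \<subseteq> {\<eta>\<^sub>0..<\<delta>}"
    by (rule step_equal[OF \<gamma> \<rho> \<open>\<eta>\<^sub>0 < \<delta>\<close>])
  note 1 = extends_byD[OF ext1, of L, OF L_def[THEN meta_eq_to_obj_eq]]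
  obtain \<gamma>' \<rho>' N where ext2: "extends_by (<) \<gamma>\<^sub>1 \<rho>\<^sub>1 \<gamma>' \<rho>' N"
    by (rule step_greater[OF 1(1,2)])
  note 2 = extends_byD[OF ext2 1(3)[symmetric]]
  have finLM: "finite (L \<union> M)" "L \<union> M \<noteq> {}"
    using finL 1(4,5) by auto
  show ?thesis
  proof (rule that[OF 2(1-3)])
    show "e (b \<rho>') (Max (L \<union> M \<union> N)) < e \<alpha>' (Max (L \<union> M \<union> N))" if "\<alpha>' \<in> a \<gamma>'" for \<alpha>'
      using Max_concat[OF finLM(1) 2(4-6)] 2(9)[OF that Max_in[OF 2(4,5)]] by simp
    show "\<exists>\<alpha>\<in>a \<gamma>. (\<forall>\<zeta>\<in>L. e \<alpha>' \<zeta> = e \<alpha> \<zeta>) \<and>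
      osc_count (e \<alpha>') (e (b \<rho>')) (L \<union> M \<union> N) = Suc (osc_count (e \<alpha>) (e (b \<rho>)) L)"
      if \<alpha>': "\<alpha>' \<in> a \<gamma>'" for \<alpha>'
    proof -
      obtain \<alpha>\<^sub>1 where \<alpha>\<^sub>1: "\<alpha>\<^sub>1 \<in> a \<gamma>\<^sub>1" "\<And>\<zeta>. \<zeta> \<in> L \<union> M \<Longrightarrow> e \<alpha>' \<zeta> = e \<alpha>\<^sub>1 \<zeta>"
        using 2(8)[OF \<alpha>'] by blast
      obtain \<alpha> where \<alpha>: "\<alpha> \<in> a \<gamma>" "\<And>\<zeta>. \<zeta> \<in> L \<Longrightarrow> e \<alpha>\<^sub>1 \<zeta> = e \<alpha> \<zeta>"
        using 1(8)[OF \<alpha>\<^sub>1(1)] by blast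
      have eq: "e \<alpha>' \<zeta> = e (b \<rho>') \<zeta>" if "\<zeta> \<in> M" for \<zeta>
        using that \<alpha>\<^sub>1 1(9) 2(7) by simp
      have "Max (L \<union> M) \<in> M"
        using Max_concat[OF finL 1(4-6)] Max_in[OF 1(4,5)] by simp
      then have "osc_count (e \<alpha>') (e (b \<rho>')) (L \<union> M \<union> N) = Suc (osc_count (e \<alpha>') (e (b \<rho>')) (L \<union> M))"
        using osc_count_concat_greater[OF finLM(1) 2(4) finLM(2) 2(5,6) 2(9)[OF \<alpha>']] eq by simp
      also have "osc_count (e \<alpha>') (e (b \<rho>')) (L \<union> M) = osc_count (e \<alpha>') (e (b \<rho>')) L"
        using osc_count_concat_eq[OF finL 1(4) ne 1(5,6)] eq by simp
      also have "\<dots> = osc_count (e \<alpha>) (e (b \<rho>)) L"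
        using finL \<alpha> \<alpha>\<^sub>1 1(7) 2(7) by (intro osc_count_cong) auto
      finally show ?thesis
        using \<alpha> \<alpha>\<^sub>1 by auto
    qed
  qed auto
qed

text \<open>A single \<open>\<gamma>\<close> serves all the \<open>\<rho> j\<close>: as the traces increase with \<open>j\<close>, every later choice of \<open>\<gamma>\<close>
  preserves what has been achieved on the earlier ones. All traces end in a point with
  \<open>e\<^sub>\<alpha> > e\<^sub>b\<close>, so that a continuation above them never oscillates at its first point.\<close>

definition ladder :: "nat \<Rightarrow> 'a \<Rightarrow> (nat \<Rightarrow> 'a) \<Rightarrow> bool"
  where "ladder n \<gamma> \<rho> \<longleftrightarrow> \<delta> \<le> \<gamma> \<and> (\<forall>j\<le>n. \<delta> \<le> \<rho> j \<and>
    (let L = lower_trace \<delta> (b (\<rho> j)) in L \<noteq> {} \<and> L \<subseteq> lower_trace \<delta> (b (\<rho> n)) \<and>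
      (\<forall>\<alpha>\<in>a \<gamma>. e (b (\<rho> j)) (Max L) < e \<alpha> (Max L) \<and>
        osc_count (e \<alpha>) (e (b (\<rho> j))) L
          = osc_count (e \<alpha>) (e (b (\<rho> 0))) (lower_trace \<delta> (b (\<rho> 0))) + j)))"

lemma ladder_exists: "\<exists>\<gamma> \<rho>. ladder n \<gamma> \<rho>"
proof (induction n)
  case 0
  obtain \<gamma> \<rho> M where ext: "extends_by (<) \<delta> \<delta> \<gamma> \<rho> M"
    by (rule step_greater[OF order_refl order_refl])
  note * = extends_byD[OF ext refl]
  have "Max (lower_trace \<delta> (b \<rho>)) \<in> M"
    using Max_concat[OF finite_lower_trace *(4-6)] Max_in[OF *(4,5)] *(3) by simp
  then have "ladder 0 \<gamma> (\<lambda>_. \<rho>)"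
    using *(1-3,5,9) by (simp add: ladder_def Let_def)
  then show ?case
    by blast
next
  case (Suc n)
  then obtain \<gamma> \<rho> where lad: "ladder n \<gamma> \<rho>"
    by blast
  define L where "L j = lower_trace \<delta> (b (\<rho> j))" for j
  have \<gamma>: "\<delta> \<le> \<gamma>" and \<rho>: "\<And>j. j \<le> n \<Longrightarrow> \<delta> \<le> \<rho> j" and ne: "\<And>j. j \<le> n \<Longrightarrow> L j \<noteq> {}"
    and sub: "\<And>j. j \<le> n \<Longrightarrow> L j \<subseteq> L n"
    and last: "\<And>j \<alpha>. j \<le> n \<Longrightarrow> \<alpha> \<in> a \<gamma> \<Longrightarrow> e (b (\<rho> j)) (Max (L j)) < e \<alpha> (Max (L j))"
    and cnt: "\<And>j \<alpha>. j \<le> n \<Longrightarrow> \<alpha> \<in> a \<gamma> \<Longrightarrow>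
      osc_count (e \<alpha>) (e (b (\<rho> j))) (L j) = osc_count (e \<alpha>) (e (b (\<rho> 0))) (L 0) + j"
    using lad unfolding ladder_def L_def Let_def by blast+
  obtain \<gamma>' \<rho>' L' where *: "\<delta> \<le> \<gamma>'" "\<delta> \<le> \<rho>'" "lower_trace \<delta> (b \<rho>') = L'" "L n \<subseteq> L'"
    "\<And>\<alpha>'. \<alpha>' \<in> a \<gamma>' \<Longrightarrow> e (b \<rho>') (Max L') < e \<alpha>' (Max L')"
    "\<And>\<alpha>'. \<alpha>' \<in> a \<gamma>' \<Longrightarrow> \<exists>\<alpha>\<in>a \<gamma>. (\<forall>\<zeta>\<in>L n. e \<alpha>' \<zeta> = e \<alpha> \<zeta>) \<and>
      osc_count (e \<alpha>') (e (b \<rho>')) L' = Suc (osc_count (e \<alpha>) (e (b (\<rho> n))) (L n))"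
    using double_step[OF \<gamma> \<rho>[OF order_refl], folded L_def, OF ne[OF order_refl] last[OF order_refl]]
    by blast
  have finL: "finite (L j)" for j
    unfolding L_def by (rule finite_lower_trace)
  have main: "e (b (\<rho> j)) (Max (L j)) < e \<alpha>' (Max (L j)) \<and>
      osc_count (e \<alpha>') (e (b (\<rho> j))) (L j) = osc_count (e \<alpha>') (e (b (\<rho> 0))) (L 0) + j \<and>
      osc_count (e \<alpha>') (e (b \<rho>')) L' = osc_count (e \<alpha>') (e (b (\<rho> 0))) (L 0) + Suc n"
    if \<alpha>': "\<alpha>' \<in> a \<gamma>'" and j: "j \<le> n" for \<alpha>' j
  proof -
    obtain \<alpha> where \<alpha>: "\<alpha> \<in> a \<gamma>" "\<And>\<zeta>. \<zeta> \<in> L n \<Longrightarrow> e \<alpha>' \<zeta> = e \<alpha> \<zeta>"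
      "osc_count (e \<alpha>') (e (b \<rho>')) L' = Suc (osc_count (e \<alpha>) (e (b (\<rho> n))) (L n))"
      using *(6)[OF \<alpha>'] by blast
    have same: "osc_count (e \<alpha>') h (L i) = osc_count (e \<alpha>) h (L i)" if "i \<le> n" for i h
      using \<alpha>(2) sub[OF that] finL by (intro osc_count_cong) auto
    have "e \<alpha>' (Max (L j)) = e \<alpha> (Max (L j))"
      using \<alpha>(2) sub[OF j] Max_in[OF finL ne[OF j]] by blast
    then show ?thesis
      using last[OF j \<alpha>(1)] cnt[OF j \<alpha>(1)] cnt[OF order_refl \<alpha>(1)] \<alpha>(3) same[OF j] same[of 0] by simp
  qed
  have "ladder (Suc n) \<gamma>' (\<rho>(Suc n := \<rho>'))"
    unfolding ladder_def Let_def
  proof (intro conjI allI impI)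
    fix j
    assume "j \<le> Suc n"
    then have j: "j \<le> n \<or> j = Suc n"
      by linarith
    have L': "L' \<noteq> {}"
      using ne[of n] *(4) by blast
    show "\<delta> \<le> (\<rho>(Suc n := \<rho>')) j"
      using j \<rho> *(2) by auto
    show "lower_trace \<delta> (b ((\<rho>(Suc n := \<rho>')) j)) \<noteq> {}"
      using j ne *(3) L' by (auto simp: L_def)
    show "lower_trace \<delta> (b ((\<rho>(Suc n := \<rho>')) j)) \<subseteq> lower_trace \<delta> (b ((\<rho>(Suc n := \<rho>')) (Suc n)))"
      using j sub *(3,4) by (auto simp: L_def)
    show "\<forall>\<alpha>\<in>a \<gamma>'. e (b ((\<rho>(Suc n := \<rho>')) j)) (Max (lower_trace \<delta> (b ((\<rho>(Suc n := \<rho>')) j))))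
        < e \<alpha> (Max (lower_trace \<delta> (b ((\<rho>(Suc n := \<rho>')) j)))) \<and>
      osc_count (e \<alpha>) (e (b ((\<rho>(Suc n := \<rho>')) j))) (lower_trace \<delta> (b ((\<rho>(Suc n := \<rho>')) j)))
      = osc_count (e \<alpha>) (e (b ((\<rho>(Suc n := \<rho>')) 0))) (lower_trace \<delta> (b ((\<rho>(Suc n := \<rho>')) 0))) + j"
      using j
    proof
      assume "j \<le> n"
      then show ?thesis
        using main[of _ j] by (simp add: L_def)
    next
      assume "j = Suc n"
      then show ?thesis
        using main[of _ 0] *(3,5) by (simp add: L_def)
    qed
  qed (use * in auto)
  then show ?case
    by blast
qed

text \<open>The indices of a ladder lie above \<open>\<delta>\<close>, and \<open>\<gamma>\<close> must go below all the \<open>b (\<rho> j)\<close>. Reflect it to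
  \<open>\<gamma>' < \<delta>\<close> of the same type, close enough to \<open>\<delta>\<close> that \<open>L(\<alpha>, b (\<rho> j)) = L(\<delta>, b (\<rho> j)) \<union> L(\<alpha>,\<delta>)\<close> and
  that all \<open>e\<close> at \<open>b (\<rho> j)\<close> coincide with \<open>e\<^sub>\<delta>\<close> on \<open>L(\<alpha>,\<delta>)\<close>; the upper part then contributes
  the same number for all \<open>j\<close>.\<close>

lemma osc_increments_at:
  "\<exists>\<gamma> \<rho>. \<forall>m\<le>n. \<gamma> < \<rho> m \<and> (\<forall>\<alpha>\<in>a \<gamma>. \<alpha> < b (\<rho> m) \<and> osc \<alpha> (b (\<rho> m)) = osc \<alpha> (b (\<rho> 0)) + m)"
proof -
  obtain \<gamma> \<rho> where lad: "ladder n \<gamma> \<rho>"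
    using ladder_exists by blast
  define L where "L j = lower_trace \<delta> (b (\<rho> j))" for j
  have \<gamma>: "\<delta> \<le> \<gamma>" and \<rho>: "\<And>j. j \<le> n \<Longrightarrow> \<delta> \<le> \<rho> j" and ne: "\<And>j. j \<le> n \<Longrightarrow> L j \<noteq> {}"
    and sub: "\<And>j. j \<le> n \<Longrightarrow> L j \<subseteq> L n"
    and last: "\<And>j \<alpha>. j \<le> n \<Longrightarrow> \<alpha> \<in> a \<gamma> \<Longrightarrow> e (b (\<rho> j)) (Max (L j)) < e \<alpha> (Max (L j))"
    and cnt: "\<And>j \<alpha>. j \<le> n \<Longrightarrow> \<alpha> \<in> a \<gamma> \<Longrightarrow>
      osc_count (e \<alpha>) (e (b (\<rho> j))) (L j) = osc_count (e \<alpha>) (e (b (\<rho> 0))) (L 0) + j"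
    using lad unfolding ladder_def L_def Let_def by blast+
  have finL: "finite (L j)" for j
    unfolding L_def by (rule finite_lower_trace)
  have b\<delta>: "\<delta> \<le> b (\<rho> j)" if "j \<le> n" for j
    using \<rho>[OF that] b_ge[of "\<rho> j"] by simp
  obtain \<eta>\<^sub>1 where \<eta>\<^sub>1: "\<eta>\<^sub>1 < \<delta>"
    "\<And>\<beta> \<zeta>. \<beta> \<in> (\<lambda>j. b (\<rho> j)) ` {..n} \<Longrightarrow> \<eta>\<^sub>1 \<le> \<zeta> \<Longrightarrow> \<zeta> < \<delta> \<Longrightarrow> e \<beta> \<zeta> = e \<delta> \<zeta>"
    using eventually_coherent[of "(\<lambda>j. b (\<rho> j)) ` {..n}"] b\<delta> by blast
  have "insert \<eta>\<^sub>1 (L n) \<subseteq> {..<\<delta>}"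
    using \<eta>\<^sub>1(1) lower_trace_subset by (auto simp: L_def)
  then obtain \<eta> where \<eta>: "\<eta> < \<delta>" "insert \<eta>\<^sub>1 (L n) \<subseteq> {..<\<eta>}"
    using finite_bounded_below_\<delta>[of "insert \<eta>\<^sub>1 (L n)"] finL by blast
  obtain \<xi>\<^sub>0 where \<xi>\<^sub>0: "\<xi>\<^sub>0 < \<delta>"
    "\<And>\<xi>. \<xi>\<^sub>0 \<le> \<xi> \<Longrightarrow> \<xi> < \<delta> \<Longrightarrow> lower_trace \<xi> \<delta> \<noteq> {} \<and> lower_trace \<xi> \<delta> \<subseteq> {\<eta>..}"
    using lower_trace_tends_to_limit[OF limit_\<delta> \<eta>(1)] by blast
  define \<Phi> where "\<Phi> = (\<lambda>\<alpha>. restr (L n) (e \<alpha>)) ` a \<gamma>"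
  have "(L n, \<Phi>, restr (L n) undefined) \<in> params \<eta>"
    unfolding params_def \<Phi>_def Fpow_def using finL \<eta>(2) finite_a restr_supported by auto
  then have P: "matching (L n) \<Phi> \<in> reflected_sets \<eta>"
    unfolding reflected_sets_def by blast
  have "\<gamma> \<in> matching (L n) \<Phi>"
    by (simp add: matching_def \<Phi>_def)
  then obtain \<gamma>' where \<gamma>': "\<gamma>' \<in> matching (L n) \<Phi>" "\<xi>\<^sub>0 < \<gamma>'" "\<gamma>' < \<delta>"
    using reflectingD(2)[OF reflecting \<eta>(1) P _ \<gamma> \<xi>\<^sub>0(1)] by blast
  have below: "\<alpha> < \<delta>" if "\<alpha> \<in> a \<gamma>'" for \<alpha>
    using reflecting_singleton[OF reflecting \<gamma>'(3)] that by (auto simp: reflected_sets_def)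
  have formula: "osc \<alpha> (b (\<rho> m)) = osc_count (e \<alpha>) (e (b (\<rho> 0))) (L 0) + m
      + osc_count (e \<alpha>) (e \<delta>) (lower_trace \<alpha> \<delta>)"
    if \<alpha>: "\<alpha> \<in> a \<gamma>'" and m: "m \<le> n" for \<alpha> m
  proof -
    let ?G = "lower_trace \<alpha> \<delta>"
    have "\<xi>\<^sub>0 \<le> \<alpha>"
      using a_ge[OF \<alpha>] \<gamma>'(2) by simp
    then have G: "?G \<noteq> {}" "?G \<subseteq> {\<eta>..}" "finite ?G"
      using \<xi>\<^sub>0(2) below[OF \<alpha>] finite_lower_trace by auto
    have less: "\<xi> < \<zeta>" if "\<xi> \<in> L m" "\<zeta> \<in> ?G" for \<xi> \<zeta>
      using that G(2) sub[OF m] \<eta>(2) by fastforce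
    obtain \<alpha>\<^sub>0 where \<alpha>\<^sub>0: "\<alpha>\<^sub>0 \<in> a \<gamma>" "\<And>\<zeta>. \<zeta> \<in> L n \<Longrightarrow> e \<alpha> \<zeta> = e \<alpha>\<^sub>0 \<zeta>"
      using matching_restr_image[OF \<gamma>'(1)[unfolded \<Phi>_def]] \<alpha> by blast
    have same: "osc_count (e \<alpha>) h (L i) = osc_count (e \<alpha>\<^sub>0) h (L i)" if "i \<le> n" for i h
      using \<alpha>\<^sub>0(2) sub[OF that] finL by (intro osc_count_cong) auto
    have "e \<alpha> (Max (L m)) = e \<alpha>\<^sub>0 (Max (L m))"
      using \<alpha>\<^sub>0(2) sub[OF m] Max_in[OF finL ne[OF m]] by blast
    then have noosc: "\<not> e \<alpha> (Max (L m)) \<le> e (b (\<rho> m)) (Max (L m))"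
      using last[OF m \<alpha>\<^sub>0(1)] by simp
    have "osc \<alpha> (b (\<rho> m)) = osc_count (e \<alpha>) (e (b (\<rho> m))) (L m \<union> ?G)"
      unfolding osc_eq_osc_count L_def
      by (subst lower_trace_concat[of \<alpha> \<delta>]) (use below[OF \<alpha>] b\<delta>[OF m] G less in \<open>auto simp: L_def\<close>)
    also have "\<dots> = osc_count (e \<alpha>) (e (b (\<rho> m))) (L m) + osc_count (e \<alpha>) (e (b (\<rho> m))) ?G"
      using osc_count_concat[OF finL G(3) ne[OF m] G(1) less] noosc by simp
    also have "osc_count (e \<alpha>) (e (b (\<rho> m))) ?G = osc_count (e \<alpha>) (e \<delta>) ?G"
    proof (rule osc_count_cong[OF G(3) refl])
      fix \<zeta>
      assume "\<zeta> \<in> ?G"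
      then have "\<eta> \<le> \<zeta>" "\<zeta> < \<delta>"
        using G(2) lower_trace_subset below[OF \<alpha>] by (fastforce dest: less_trans)+
      then show "e (b (\<rho> m)) \<zeta> = e \<delta> \<zeta>"
        using \<eta>\<^sub>1(2)[of "b (\<rho> m)" \<zeta>] \<eta>(2) m by auto
    qed
    finally show ?thesis
      using cnt[OF m \<alpha>\<^sub>0(1)] same[OF m] same[of 0] by simp
  qed
  have "\<gamma>' < \<rho> m \<and> (\<forall>\<alpha>\<in>a \<gamma>'. \<alpha> < b (\<rho> m) \<and> osc \<alpha> (b (\<rho> m)) = osc \<alpha> (b (\<rho> 0)) + m)"
    if m: "m \<le> n" for m
    using formula[OF _ m] formula[of _ 0] \<gamma>'(3) \<rho>[OF m] less_le_trans[OF below b\<delta>[OF m]] by auto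
  then show ?thesis
    by blast
qed

end

text \<open>Moore's oscillation theorem, for finite sets on the left and single ordinals on the right.\<close>

theorem (in indexed_families) osc_increments:
  obtains \<gamma> \<rho> where "\<And>m. m \<le> n \<Longrightarrow> \<gamma> < \<rho> m" "\<And>m \<alpha>. m \<le> n \<Longrightarrow> \<alpha> \<in> a \<gamma> \<Longrightarrow> \<alpha> < b (\<rho> m)"
    "\<And>m \<alpha>. m \<le> n \<Longrightarrow> \<alpha> \<in> a \<gamma> \<Longrightarrow> osc \<alpha> (b (\<rho> m)) = osc \<alpha> (b (\<rho> 0)) + m"
proof -
  obtain \<delta> where "reflecting reflected_sets \<delta>"
    using reflecting_exists[of reflected_sets] countable_reflected_sets by blast
  then interpret indexed_families_at C a b \<delta>
    by unfold_locales
  show ?thesis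
    using osc_increments_at[of n] that by metis
qed

section \<open>Simultaneous approximation on the torus\<close>

lemma unit_circle_iff_norm: "x \<in> unit_circle \<longleftrightarrow> norm x = 1"
proof -
  have "x * cnj x = 1 \<longleftrightarrow> (norm x)\<^sup>2 = 1"
    by (metis complex_norm_square of_real_eq_1_iff)
  also have "\<dots> \<longleftrightarrow> norm x = 1"
    unfolding power2_eq_1_iff using norm_ge_zero[of x] by linarith
  finally show ?thesis
    by (simp add: unit_circle_def)
qed

text \<open>The argument measured in full turns, normalized to be smaller than \<open>1\<close> so that it differs from the
  number \<open>1\<close> that is adjoined to the angles in Kronecker's theorem.\<close>

definition turn :: "complex \<Rightarrow> real"
  where "turn x = Arg x / (2 * pi)"

lemma cis_turn: "norm x = 1 \<Longrightarrow> cis (2 * pi * turn x) = x"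
  using rcis_cmod_Arg[of x] by (simp add: turn_def rcis_def)

lemma turn_less_1: "turn x < 1"
  using Arg_bounded[of x] pi_gt_zero unfolding turn_def by (simp add: divide_less_eq)

lemma norm_cis_diff_le: "norm (cis s - cis t) \<le> \<bar>s - t\<bar>"
proof -
  have "cis s - cis t = cis t * (cis (s - t) - 1)"
    by (simp add: cis_mult algebra_simps)
  then have "norm (cis s - cis t) = norm (cis (s - t) - 1)"
    by (simp add: norm_mult)
  also have "\<dots> = 2 * \<bar>sin ((s - t) / 2)\<bar>"
    unfolding cis_conv_exp by (rule dist_exp_i_1)
  also have "\<dots> \<le> \<bar>s - t\<bar>"
    using abs_sin_x_le_abs_x[of "(s - t) / 2"] by simp
  finally show ?thesis .
qed

lemma prod_cis: "(\<Prod>i\<in>I. cis (g i)) = cis (\<Sum>i\<in>I. g i)"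
  by (induction I rule: infinite_finite_induct) (simp_all add: cis_mult)

text \<open>Kronecker's theorem in multiplicative form. A linear relation with integer coefficients between
  \<open>1\<close> and the angles becomes, after exponentiation, a multiplicative relation between the \<open>z\<^sub>\<alpha>\<close>.\<close>

lemma powi_dense_in_torus:
  fixes z :: "'i \<Rightarrow> complex"
  assumes circle: "range z \<subseteq> unit_circle" and indep: "rationally_independent z"
    and "finite A" and "\<epsilon> > 0" and v: "\<And>\<alpha>. \<alpha> \<in> A \<Longrightarrow> v \<alpha> \<in> unit_circle"
  shows "\<exists>k. \<forall>\<alpha>\<in>A. norm (z \<alpha> powi k - v \<alpha>) < \<epsilon>"
proof -
  have z1: "norm (z \<alpha>) = 1" for \<alpha>
    using circle unit_circle_iff_norm by (metis range_subsetD)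
  have indepD: "n \<alpha> = 0" if "(\<Prod>\<alpha>\<in>A. z \<alpha> powi (n \<alpha>)) = 1" "\<alpha> \<in> A" "finite A" for n \<alpha> A
    using indep that unfolding rationally_independent_def by blast
  obtain f where f: "bij_betw f {..<card A} A"
    using ex_bij_betw_nat_finite[OF \<open>finite A\<close>] by (auto simp: atLeast0LessThan)
  define n where "n = card A"
  define \<theta> where "\<theta> i = (if i < n then turn (z (f i)) else 1)" for i
  have \<theta>_n: "\<theta> n = 1"
    by (simp add: \<theta>_def)
  have z_eq: "z (f i) = cis (2 * pi * \<theta> i)" if "i < n" for i
    using that cis_turn[OF z1, of "f i"] by (simp add: \<theta>_def)
  have finj: "inj_on f {..<n}" and fA: "f ` {..<n} = A"
    using f by (auto simp: bij_betw_def n_def)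
  have inj: "inj_on \<theta> {..n}"
  proof (rule linorder_inj_onI)
    fix i j
    assume ij: "i < j" "i \<in> {..n}" "j \<in> {..n}"
    show "\<theta> i \<noteq> \<theta> j"
    proof (cases "j < n")
      case False
      then show ?thesis
        using ij turn_less_1[of "z (f i)"] by (auto simp: \<theta>_def)
    next
      case True
      show ?thesis
      proof
        assume "\<theta> i = \<theta> j"
        then have eq: "z (f i) = z (f j)"
          using z_eq ij True by simp
        have ne: "f i \<noteq> f j"
          using finj ij True by (auto dest: inj_onD)
        let ?n = "\<lambda>\<alpha>. if \<alpha> = f i then 1 else (-1 :: int)"
        have "(\<Prod>\<alpha>\<in>{f i, f j}. z \<alpha> powi (?n \<alpha>)) = 1"
          using ne eq z1[of "f j"] norm_eq_zero[of "z (f j)"] by (auto simp: power_int_minus)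
        from indepD[OF this, of "f i"] show False
          by simp
      qed
    qed
  qed auto
  interpret Modules.module "\<lambda>r x. of_int r * (x :: real)"
    by standard (auto simp: algebra_simps)
  have indep\<theta>: "independent (\<theta> ` {..n})"
  proof
    assume "dependent (\<theta> ` {..n})"
    then obtain u :: "real \<Rightarrow> int" where u: "(\<Sum>t\<in>\<theta> ` {..n}. of_int (u t) * t) = 0"
      and nz: "\<exists>t\<in>\<theta> ` {..n}. u t \<noteq> 0"
      by (subst (asm) dependent_finite) auto
    have "(\<Sum>i\<le>n. of_int (u (\<theta> i)) * \<theta> i) = 0"
      using u inj by (simp add: sum.reindex)
    then have "(\<Sum>i<n. of_int (u (\<theta> i)) * \<theta> i) + of_int (u 1) = 0"
      by (simp add: \<theta>_n flip: lessThan_Suc_atMost)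
    then have sum: "(\<Sum>i<n. of_int (u (\<theta> i)) * \<theta> i) = - of_int (u 1)"
      by simp
    define m where "m \<alpha> = u (\<theta> (the_inv_into {..<n} f \<alpha>))" for \<alpha>
    have m: "m (f i) = u (\<theta> i)" if "i < n" for i
      using that finj by (simp add: m_def the_inv_into_f_f)
    have "(\<Prod>\<alpha>\<in>A. z \<alpha> powi (m \<alpha>)) = (\<Prod>i<n. z (f i) powi (u (\<theta> i)))"
      unfolding fA[symmetric] using finj m by (simp add: prod.reindex)
    also have "\<dots> = (\<Prod>i<n. cis (of_int (u (\<theta> i)) * (2 * pi * \<theta> i)))"
      by (rule prod.cong) (simp_all add: z_eq cis_power_int)
    also have "\<dots> = cis (\<Sum>i<n. of_int (u (\<theta> i)) * (2 * pi * \<theta> i))"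
      by (rule prod_cis)
    also have "(\<Sum>i<n. of_int (u (\<theta> i)) * (2 * pi * \<theta> i)) = 2 * pi * (\<Sum>i<n. of_int (u (\<theta> i)) * \<theta> i)"
      by (simp add: sum_distrib_left mult_ac)
    also have "cis \<dots> = 1"
      unfolding sum by (rule cis_multiple_2pi) simp
    finally have "m \<alpha> = 0" if "\<alpha> \<in> A" for \<alpha>
      using indepD \<open>finite A\<close> that by blast
    then have u0: "u (\<theta> i) = 0" if "i < n" for i
      using that m[OF that] fA by auto
    then have "u 1 = 0"
      using sum by simp
    then have "u (\<theta> i) = 0" if "i \<le> n" for i
      using u0[of i] that by (cases "i < n") (auto simp: \<theta>_def)
    then show False
      using nz by auto
  qed
  have "\<epsilon> / (2 * pi) > 0"
    using \<open>\<epsilon> > 0\<close> by simp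
  then obtain k m where km: "\<And>i. i < n \<Longrightarrow> \<bar>of_int k * \<theta> i - of_int (m i) - turn (v (f i))\<bar> < \<epsilon> / (2 * pi)"
    using Kronecker_thm_2[OF indep\<theta> inj \<theta>_n, of "\<epsilon> / (2 * pi)" "\<lambda>i. turn (v (f i))"] by blast
  have "norm (z \<alpha> powi k - v \<alpha>) < \<epsilon>" if "\<alpha> \<in> A" for \<alpha>
  proof -
    have "\<alpha> \<in> f ` {..<n}"
      using that fA by simp
    then obtain i where i: "i < n" "\<alpha> = f i"
      by auto
    have "z \<alpha> powi k = cis (2 * pi * (of_int k * \<theta> i))"
      by (simp add: i z_eq cis_power_int mult_ac)
    also have "\<dots> = cis (2 * pi * (of_int k * \<theta> i - of_int (m i))) * cis (2 * pi * of_int (m i))"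
      by (simp add: cis_mult algebra_simps del: cis_multiple_2pi)
    also have "cis (2 * pi * of_int (m i)) = 1"
      by (rule cis_multiple_2pi) simp
    finally have "norm (z \<alpha> powi k - v \<alpha>)
      = norm (cis (2 * pi * (of_int k * \<theta> i - of_int (m i))) - cis (2 * pi * turn (v \<alpha>)))"
      using v[OF that] by (simp add: cis_turn unit_circle_iff_norm)
    also have "\<dots> \<le> 2 * pi * \<bar>of_int k * \<theta> i - of_int (m i) - turn (v \<alpha>)\<bar>"
      by (rule order_trans[OF norm_cis_diff_le]) (simp add: abs_mult flip: right_diff_distrib)
    also have "\<dots> < \<epsilon>"
      using km[OF i(1)] i(2) by (simp add: field_simps)
    finally show ?thesis .
  qed
  then show ?thesis
    by blast
qed

text \<open>By compactness finitely many targets \<open>v\<close> suffice, which bounds the integer exponents \<open>k v\<close> by some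
  \<open>B\<close>. Starting \<open>B\<close> steps later makes the exponents nonnegative, and dividing the target by the
  starting point \<open>c\<close> makes the bound independent of \<open>c\<close>.\<close>

lemma powers_uniformly_dense_in_torus:
  fixes z :: "'i \<Rightarrow> complex"
  assumes circle: "range z \<subseteq> unit_circle" and indep: "rationally_independent z"
    and fin: "finite A" and \<epsilon>: "\<epsilon> > 0"
  shows "\<exists>N. \<forall>c u. (\<forall>\<alpha>\<in>A. c \<alpha> \<in> unit_circle \<and> u \<alpha> \<in> unit_circle) \<longrightarrow>
    (\<exists>m\<le>N. \<forall>\<alpha>\<in>A. norm (c \<alpha> * z \<alpha> ^ m - u \<alpha>) < \<epsilon>)"
proof -
  have z1: "norm (z \<alpha>) = 1" for \<alpha>
    using circle unit_circle_iff_norm by (metis range_subsetD)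
  have "unit_circle = sphere 0 1"
    by (auto simp: unit_circle_iff_norm)
  then have "compact unit_circle"
    using compact_sphere by metis
  then obtain K where K: "K \<subseteq> unit_circle" "finite K" "unit_circle \<subseteq> (\<Union>x\<in>K. ball x (\<epsilon> / 2))"
    using \<epsilon> by (rule_tac compactE_image[of unit_circle unit_circle "\<lambda>x. ball x (\<epsilon> / 2)"]) auto
  define V where "V = (A \<rightarrow>\<^sub>E K)"
  have finV: "finite V"
    unfolding V_def using fin K(2) by (rule finite_PiE)
  have "\<exists>k. \<forall>\<alpha>\<in>A. norm (z \<alpha> powi k - v \<alpha>) < \<epsilon> / 2" if "v \<in> V" for v
    using that K(1) \<epsilon> by (intro powi_dense_in_torus[OF circle indep fin]) (auto simp: V_def PiE_iff)
  then obtain k where k: "\<And>v \<alpha>. v \<in> V \<Longrightarrow> \<alpha> \<in> A \<Longrightarrow> norm (z \<alpha> powi (k v) - v \<alpha>) < \<epsilon> / 2"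
    by metis
  define B where "B = (\<Sum>v\<in>V. nat \<bar>k v\<bar>)"
  have B: "\<bar>k v\<bar> \<le> int B" if "v \<in> V" for v
  proof -
    have "nat \<bar>k v\<bar> \<le> B"
      unfolding B_def using finV that by (intro member_le_sum) auto
    then show ?thesis
      by linarith
  qed
  have "\<exists>m\<le>2 * B. \<forall>\<alpha>\<in>A. norm (c \<alpha> * z \<alpha> ^ m - u \<alpha>) < \<epsilon>"
    if cu: "\<forall>\<alpha>\<in>A. c \<alpha> \<in> unit_circle \<and> u \<alpha> \<in> unit_circle" for c u
  proof -
    define t where "t \<alpha> = u \<alpha> / (c \<alpha> * z \<alpha> ^ B)" for \<alpha>
    have t1: "norm (t \<alpha>) = 1" if "\<alpha> \<in> A" for \<alpha>
      using cu that z1[of \<alpha>] by (simp add: t_def norm_divide norm_mult norm_power unit_circle_iff_norm)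
    then have "\<exists>x\<in>K. dist x (t \<alpha>) < \<epsilon> / 2" if "\<alpha> \<in> A" for \<alpha>
      using K(3) that by (fastforce simp: unit_circle_iff_norm)
    then obtain x where x: "\<And>\<alpha>. \<alpha> \<in> A \<Longrightarrow> x \<alpha> \<in> K \<and> dist (x \<alpha>) (t \<alpha>) < \<epsilon> / 2"
      by metis
    define v where "v = restrict x A"
    have v: "v \<in> V"
      using x by (simp add: V_def v_def)
    define m where "m = nat (int B + k v)"
    have m: "int m = int B + k v" "m \<le> 2 * B"
      using B[OF v] by (auto simp: m_def)
    have "norm (c \<alpha> * z \<alpha> ^ m - u \<alpha>) < \<epsilon>" if \<alpha>: "\<alpha> \<in> A" for \<alpha>
    proof -
      have nz: "z \<alpha> \<noteq> 0" "c \<alpha> \<noteq> 0" and c1: "norm (c \<alpha>) = 1"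
        using z1[of \<alpha>] cu \<alpha> by (auto simp: unit_circle_iff_norm)
      have "z \<alpha> ^ m = z \<alpha> powi (int B + k v)"
        by (simp flip: m(1))
      then have "z \<alpha> ^ m = z \<alpha> ^ B * z \<alpha> powi k v"
        using nz by (simp add: power_int_add)
      then have "c \<alpha> * z \<alpha> ^ m - u \<alpha> = c \<alpha> * z \<alpha> ^ B * (z \<alpha> powi k v - t \<alpha>)"
        using nz by (simp add: t_def field_simps)
      then have "norm (c \<alpha> * z \<alpha> ^ m - u \<alpha>) = norm (z \<alpha> powi k v - t \<alpha>)"
        using z1 c1 by (simp add: norm_mult norm_power)
      also have "\<dots> \<le> norm (z \<alpha> powi k v - v \<alpha>) + norm (v \<alpha> - t \<alpha>)"
        by norm
      also have "\<dots> < \<epsilon>"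
        using k[OF v \<alpha>] x[OF \<alpha>] \<alpha> by (simp add: v_def dist_norm)
      finally show ?thesis .
    qed
    then show ?thesis
      using m(2) by blast
  qed
  then show ?thesis
    by blast
qed

context C_sequence
begin

section \<open>Countably many traces on every countable ordinal\<close>

text \<open>At a limit \<open>\<delta>\<close> the restriction is determined by some \<open>\<xi> < \<delta>\<close>, the restriction to \<open>\<xi>\<close>, the finite
  set \<open>F = L(\<delta>,\<beta>)\<close> and the values of \<open>e\<^sub>\<beta>\<close> on \<open>F\<close>: from \<open>\<xi>\<close> on the rest of the trace is \<open>L(\<alpha>,\<delta>)\<close>,
  which lies above the finitely many places where \<open>e\<^sub>\<beta>\<close> differs from \<open>e\<^sub>\<delta>\<close>.\<close>

lemma countable_osc_restrictions:
  "\<exists>K. countable K \<and> (\<forall>\<beta>\<ge>\<delta>. \<exists>k\<in>K. \<forall>\<alpha><\<delta>. osc \<alpha> \<beta> = k \<alpha>)"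
proof (induction \<delta> rule: less_induct)
  case (less \<delta>)
  consider "{..<\<delta>} = {}" | \<xi> where "{..<\<delta>} = {..\<xi>}" | "limit_ordinal \<delta>"
    unfolding limit_ordinal_def by blast
  then show ?case
  proof cases
    case 1
    then show ?thesis
      by (intro exI[of _ "{undefined}"]) auto
  next
    case 2
    then have "\<alpha> < \<delta> \<longleftrightarrow> \<alpha> \<le> \<xi>" for \<alpha>
      by (metis atMost_iff lessThan_iff)
    then have \<xi>: "\<xi> < \<delta>" and below: "\<And>\<alpha>. \<alpha> < \<delta> \<Longrightarrow> \<alpha> < \<xi> \<or> \<alpha> = \<xi>"
      by (auto simp: le_less)
    obtain K where K: "countable K" "\<And>\<beta>. \<xi> \<le> \<beta> \<Longrightarrow> \<exists>k\<in>K. \<forall>\<alpha><\<xi>. osc \<alpha> \<beta> = k \<alpha>"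
      using less[OF \<xi>] by blast
    let ?K = "(\<lambda>(k, n). k(\<xi> := n)) ` (K \<times> UNIV)"
    have "\<exists>k\<in>?K. \<forall>\<alpha><\<delta>. osc \<alpha> \<beta> = k \<alpha>" if "\<delta> \<le> \<beta>" for \<beta>
    proof -
      have "\<xi> \<le> \<beta>"
        using \<xi> that by simp
      then obtain k where k: "k \<in> K" "\<forall>\<alpha><\<xi>. osc \<alpha> \<beta> = k \<alpha>"
        using K(2) by blast
      have "k(\<xi> := osc \<xi> \<beta>) \<in> ?K"
        using k(1) by force
      moreover have "\<forall>\<alpha><\<delta>. osc \<alpha> \<beta> = (k(\<xi> := osc \<xi> \<beta>)) \<alpha>"
        using k(2) below by auto
      ultimately show ?thesis
        by blast
    qed
    moreover have "countable ?K"
      using K(1) by simp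
    ultimately show ?thesis
      by blast
  next
    case 3
    have "\<forall>\<xi>\<in>{..<\<delta>}. \<exists>K. countable K \<and> (\<forall>\<beta>\<ge>\<xi>. \<exists>k\<in>K. \<forall>\<alpha><\<xi>. osc \<alpha> \<beta> = k \<alpha>)"
      using less by simp
    then obtain K where K: "\<And>\<xi>. \<xi> < \<delta> \<Longrightarrow> countable (K \<xi>)"
      "\<And>\<xi> \<beta>. \<xi> < \<delta> \<Longrightarrow> \<xi> \<le> \<beta> \<Longrightarrow> \<exists>k\<in>K \<xi>. \<forall>\<alpha><\<xi>. osc \<alpha> \<beta> = k \<alpha>"
      by (auto dest!: bchoice)
    \<comment> \<open>\<open>h\<close> recovers the restriction from its countably many codes; outside \<open>F\<close> the function \<open>e\<^sub>\<delta>\<close> replaces \<open>e\<^sub>\<beta>\<close>.\<close>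
    define h where "h = (\<lambda>(\<xi>, k, F, g) \<alpha>. if \<alpha> < \<xi> then k \<alpha> else
      osc_count (e \<alpha>) (\<lambda>\<zeta>. if \<zeta> \<in> F then g \<zeta> else e \<delta> \<zeta>) (F \<union> lower_trace \<alpha> \<delta>))"
    define P where "P = (SIGMA \<xi> : {..<\<delta>}. K \<xi> \<times> (SIGMA F : Fpow {..<\<delta>}. supported F))"
    have "countable (supported F)" if "F \<in> Fpow {..<\<delta>}" for F
      using that by (intro countable_supported) (simp add: Fpow_def)
    then have "countable P"
      unfolding P_def using K(1) countable_lessThan by (intro countable_SIGMA countable_Fpow) auto
    moreover have "\<exists>k\<in>h ` P. \<forall>\<alpha><\<delta>. osc \<alpha> \<beta> = k \<alpha>" if \<beta>: "\<delta> \<le> \<beta>" for \<beta>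
    proof -
      let ?F = "lower_trace \<delta> \<beta>"
      have F: "finite ?F" "?F \<subseteq> {..<\<delta>}"
        using finite_lower_trace lower_trace_subset by auto
      have "finite (?F \<union> {\<zeta>. \<zeta> < \<delta> \<and> e \<delta> \<zeta> \<noteq> e \<beta> \<zeta>})"
        using F e_coherent[OF \<beta>] by simp
      then obtain \<eta> where \<eta>: "\<eta> < \<delta>" "\<And>\<zeta>. \<zeta> \<in> ?F \<union> {\<zeta>. \<zeta> < \<delta> \<and> e \<delta> \<zeta> \<noteq> e \<beta> \<zeta>} \<Longrightarrow> \<zeta> < \<eta>"
        by (rule limit_ordinal_strictly_bounds_finite[OF 3]) (use F in auto)
      obtain \<xi> where \<xi>: "\<xi> < \<delta>"
        "\<And>\<alpha>. \<xi> \<le> \<alpha> \<Longrightarrow> \<alpha> < \<delta> \<Longrightarrow> lower_trace \<alpha> \<delta> \<noteq> {} \<and> lower_trace \<alpha> \<delta> \<subseteq> {\<eta>..}"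
        using lower_trace_tends_to_limit[OF 3 \<eta>(1)] by blast
      have "\<xi> \<le> \<beta>"
        using \<xi>(1) \<beta> by simp
      then obtain k where k: "k \<in> K \<xi>" "\<forall>\<alpha><\<xi>. osc \<alpha> \<beta> = k \<alpha>"
        using K(2)[OF \<xi>(1)] by blast
      let ?p = "(\<xi>, k, ?F, restr ?F (e \<beta>))"
      have "?p \<in> P"
        using \<xi>(1) k(1) F by (simp add: P_def Fpow_def restr_supported)
      moreover have "osc \<alpha> \<beta> = h ?p \<alpha>" if "\<alpha> < \<delta>" for \<alpha>
      proof (cases "\<alpha> < \<xi>")
        case True
        then show ?thesis
          using k(2) by (simp add: h_def)
      next
        case False
        let ?G = "lower_trace \<alpha> \<delta>"
        have G: "?G \<noteq> {}" "?G \<subseteq> {\<eta>..}" "?G \<subseteq> {..<\<delta>}" "finite ?G"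
          using \<xi>(2)[of \<alpha>] False that lower_trace_subset[of \<alpha> \<delta>] finite_lower_trace by auto
        have L: "lower_trace \<alpha> \<beta> = ?F \<union> ?G"
          by (rule lower_trace_concat) (use that \<beta> G \<eta>(2) in \<open>fastforce+\<close>)
        have "e \<beta> \<zeta> = (if \<zeta> \<in> ?F then restr ?F (e \<beta>) \<zeta> else e \<delta> \<zeta>)" if \<zeta>: "\<zeta> \<in> ?F \<union> ?G" for \<zeta>
        proof (cases "\<zeta> \<in> ?F")
          case True
          then show ?thesis
            by (simp add: restr_def)
        next
          case False
          then have "\<eta> \<le> \<zeta>" "\<zeta> < \<delta>"
            using \<zeta> G by auto
          then show ?thesis
            using \<eta>(2)[of \<zeta>] False by fastforce
        qed
        then have "osc \<alpha> \<beta> = osc_count (e \<alpha>) (\<lambda>\<zeta>. if \<zeta> \<in> ?F then restr ?F (e \<beta>) \<zeta> else e \<delta> \<zeta>) (?F \<union> ?G)"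
          unfolding osc_eq_osc_count L using F G by (intro osc_count_cong) auto
        then show ?thesis
          using False by (simp add: h_def)
      qed
      ultimately show ?thesis
        by blast
    qed
    ultimately show ?thesis
      using countable_image by blast
  qed
qed

lemma w_below: "\<alpha> < \<beta> \<Longrightarrow> w z \<beta> \<alpha> = z \<alpha> ^ (osc \<alpha> \<beta> + 1)"
  by (simp add: w_def o_fun_def)

lemma indistinguishable_pair: "\<exists>\<beta>\<ge>\<delta>. \<exists>\<gamma>>\<beta>. \<forall>\<alpha><\<delta>. w z \<beta> \<alpha> = w z \<gamma> \<alpha>"
proof -
  obtain K where K: "countable K" "\<forall>\<beta>\<ge>\<delta>. \<exists>k\<in>K. \<forall>\<alpha><\<delta>. osc \<alpha> \<beta> = k \<alpha>"
    using countable_osc_restrictions by blast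
  then obtain k where k: "\<And>\<beta>. \<delta> \<le> \<beta> \<Longrightarrow> k \<beta> \<in> K" "\<And>\<beta> \<alpha>. \<delta> \<le> \<beta> \<Longrightarrow> \<alpha> < \<delta> \<Longrightarrow> osc \<alpha> \<beta> = k \<beta> \<alpha>"
    by metis
  have "\<not> countable {\<delta>..}"
  proof
    assume "countable {\<delta>..}"
    then have "countable ({..<\<delta>} \<union> {\<delta>..})"
      using countable_lessThan by simp
    moreover have "{..<\<delta>} \<union> {\<delta>..} = UNIV"
      by auto
    ultimately show False
      using uncountable_UNIV by metis
  qed
  then have "\<not> inj_on k {\<delta>..}"
    using K(1) k(1) by (meson atLeast_iff countable_image_inj_on countable_subset image_subsetI)
  then obtain \<beta> \<gamma> where "\<delta> \<le> \<beta>" "\<delta> \<le> \<gamma>" "\<beta> < \<gamma>" "k \<beta> = k \<gamma>"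
    unfolding inj_on_def by (metis atLeast_iff linorder_neqE)
  moreover from this have "w z \<beta> \<alpha> = w z \<gamma> \<alpha>" if "\<alpha> < \<delta>" for \<alpha>
    using that k(2) w_below[of \<alpha> \<beta>] w_below[of \<alpha> \<gamma>] by (metis order_less_le_trans)
  ultimately show ?thesis
    by blast
qed

end

locale moore_data = C_sequence C for C :: "'a::omega1 \<Rightarrow> 'a set" +
  fixes z :: "'a \<Rightarrow> complex"
  assumes z_circle: "range z \<subseteq> unit_circle"
    and z_independent: "rationally_independent z"
begin

lemma norm_z: "norm (z \<alpha>) = 1"
  using z_circle unit_circle_iff_norm by (metis range_subsetD)

lemma w_circle: "w z \<beta> \<alpha> \<in> unit_circle"
  by (simp add: unit_circle_iff_norm w_def o_fun_def norm_power norm_mult norm_z)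

lemma z_power_neq_1:
  assumes "n > 0"
  shows "z \<alpha> ^ n \<noteq> 1"
  using z_independent[unfolded rationally_independent_def, rule_format, of "{\<alpha>}" "\<lambda>_. int n" \<alpha>] assms
  by auto

lemma inj_w: "inj (w z)"
proof (rule linorder_injI)
  fix \<beta> \<gamma> :: 'a
  assume "\<beta> < \<gamma>"
  then have "w z \<beta> \<beta> = 1" "w z \<gamma> \<beta> \<noteq> 1"
    using z_power_neq_1[of "Suc (osc \<beta> \<gamma>)" \<beta>] by (auto simp: w_def o_fun_def)
  then show "w z \<beta> \<noteq> w z \<gamma>"
    by auto
qed

section \<open>Every open set depends on countably many coordinates\<close>

text \<open>Basic neighbourhoods of the space, as sets of indices of points.\<close>

definition box :: "'a set \<Rightarrow> real \<Rightarrow> 'a \<Rightarrow> 'a set"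
  where "box A \<epsilon> \<beta> = {\<gamma>. \<forall>\<alpha>\<in>A. norm (w z \<gamma> \<alpha> - w z \<beta> \<alpha>) < \<epsilon>}"

text \<open>Choose \<open>p \<delta> \<in> I\<close> outside all the boxes of indices below \<open>\<delta>\<close>. The finite part of the coordinates
  \<open>A (p \<delta>)\<close> below \<open>\<delta>\<close>, the oscillations of \<open>p \<delta>\<close> there and the length \<open>N \<delta>\<close> of a
  sufficiently dense orbit are pressed down: they are constant on an unbounded set \<open>Q\<close>. On \<open>Q\<close> the
  function \<open>p\<close> is increasing and no \<open>p\<close>-value lies in the box of a smaller one. Moore's theorem
  applied to the coordinates from \<open>\<delta>\<close> on contradicts that.\<close>

lemma countable_subcover:
  assumes fin: "\<And>\<beta>. finite (A \<beta>)" and pos: "\<And>\<beta>. \<epsilon> \<beta> > 0"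
  shows "\<exists>\<delta>. I \<subseteq> (\<Union>\<beta>\<in>I \<inter> {..<\<delta>}. box (A \<beta>) (\<epsilon> \<beta>) \<beta>)"
proof (rule ccontr)
  assume "\<not> ?thesis"
  then have "\<forall>\<delta>. \<exists>p\<in>I. \<forall>\<beta>\<in>I. \<beta> < \<delta> \<longrightarrow> p \<notin> box (A \<beta>) (\<epsilon> \<beta>) \<beta>"
    by blast
  then obtain p where pI: "\<And>\<delta>. p \<delta> \<in> I"
    and p: "\<And>\<delta> \<beta>. \<beta> \<in> I \<Longrightarrow> \<beta> < \<delta> \<Longrightarrow> p \<delta> \<notin> box (A \<beta>) (\<epsilon> \<beta>) \<beta>"
    by metis
  have p_ge: "\<delta> \<le> p \<delta>" for \<delta>
    using p[OF pI, of \<delta> \<delta>] pos by (auto simp: box_def not_less[symmetric])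
  \<comment> \<open>The coordinate \<open>p \<delta>\<close> is added so that points found above \<open>B\<close> are later than \<open>p \<delta>\<close>.\<close>
  define B where "B \<delta> = insert (p \<delta>) (A (p \<delta>) - {..<\<delta>})" for \<delta>
  have finB: "finite (B \<delta>)" for \<delta>
    by (simp add: B_def fin)
  define dense where "dense N \<delta> \<longleftrightarrow> (\<forall>c u. (\<forall>\<alpha>\<in>B \<delta>. c \<alpha> \<in> unit_circle \<and> u \<alpha> \<in> unit_circle) \<longrightarrow>
    (\<exists>m\<le>N. \<forall>\<alpha>\<in>B \<delta>. norm (c \<alpha> * z \<alpha> ^ m - u \<alpha>) < \<epsilon> (p \<delta>)))" for N \<delta>
  have "\<exists>N. dense N \<delta>" for \<delta>
    unfolding dense_def by (rule powers_uniformly_dense_in_torus[OF z_circle z_independent finB pos])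
  then obtain N where N: "\<And>\<delta>. dense (N \<delta>) \<delta>"
    by metis
  define Q where "Q r t n = {\<delta>. A (p \<delta>) \<inter> {..<\<delta>} = r \<and> restr r (\<lambda>\<alpha>. osc \<alpha> (p \<delta>)) = t \<and> N \<delta> = n \<and>
    (\<forall>\<eta><\<delta>. p \<eta> < \<delta>)}" for r t n
  define \<Q> where "\<Q> \<gamma> = insert {p \<gamma>} ((\<lambda>(r, t, n). Q r t n) ` (SIGMA r : Fpow {..<\<gamma>}. supported r \<times> UNIV))" for \<gamma>
  have "countable (\<Q> \<gamma>)" for \<gamma>
  proof -
    have "countable (supported r)" if "r \<in> Fpow {..<\<gamma>}" for r
      using that by (intro countable_supported) (simp add: Fpow_def)
    then show ?thesis
      unfolding \<Q>_def using countable_lessThan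
      by (intro countable_insert countable_image countable_SIGMA countable_Fpow) auto
  qed
  then obtain \<delta> where refl: "reflecting \<Q> \<delta>"
    using reflecting_exists by blast
  define r where "r = A (p \<delta>) \<inter> {..<\<delta>}"
  define t where "t = restr r (\<lambda>\<alpha>. osc \<alpha> (p \<delta>))"
  have fin_r: "finite r" "r \<subseteq> {..<\<delta>}"
    by (auto simp: r_def fin)
  obtain \<gamma>\<^sub>0 where \<gamma>\<^sub>0: "\<gamma>\<^sub>0 < \<delta>" "\<And>\<alpha>. \<alpha> \<in> r \<Longrightarrow> \<alpha> < \<gamma>\<^sub>0"
    using limit_ordinal_strictly_bounds_finite[OF reflecting_limit[OF refl] fin_r] by blast
  have "p \<eta> < \<delta>" if "\<eta> < \<delta>" for \<eta>
    by (rule reflecting_singleton[OF refl that]) (simp add: \<Q>_def)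
  then have \<delta>Q: "\<delta> \<in> Q r t (N \<delta>)"
    by (simp add: Q_def r_def t_def)
  have "(r, t, N \<delta>) \<in> (SIGMA r : Fpow {..<\<gamma>\<^sub>0}. supported r \<times> UNIV)"
    using fin_r \<gamma>\<^sub>0(2) by (auto simp: Fpow_def t_def restr_supported)
  then have "Q r t (N \<delta>) \<in> \<Q> \<gamma>\<^sub>0"
    unfolding \<Q>_def by (intro insertI2 image_eqI[of _ _ "(r, t, N \<delta>)"]) auto
  then have "unbounded (Q r t (N \<delta>))"
    using reflectingD(1)[OF refl \<gamma>\<^sub>0(1) _ \<delta>Q] by blast
  then obtain q where q: "\<And>\<gamma>. q \<gamma> \<in> Q r t (N \<delta>)" "\<And>\<gamma>. \<gamma> < q \<gamma>"
    unfolding unbounded_def by metis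
  have q_r: "A (p (q \<gamma>)) \<inter> {..<q \<gamma>} = r" and q_t: "restr r (\<lambda>\<alpha>. osc \<alpha> (p (q \<gamma>))) = t"
    and q_N: "N (q \<gamma>) = N \<delta>" and q_p: "\<And>\<eta>. \<eta> < q \<gamma> \<Longrightarrow> p \<eta> < q \<gamma>" for \<gamma>
    using q(1)[of \<gamma>] by (auto simp: Q_def)
  interpret F: indexed_families C "\<lambda>\<gamma>. B (q \<gamma>)" "\<lambda>\<gamma>. p (q \<gamma>)"
  proof
    show "finite (B (q \<gamma>))" for \<gamma>
      by (rule finB)
    show pq: "\<gamma> \<le> p (q \<gamma>)" for \<gamma>
      using q(2)[of \<gamma>] p_ge[of "q \<gamma>"] by simp
    show "\<gamma> \<le> \<alpha>" if "\<alpha> \<in> B (q \<gamma>)" for \<alpha> \<gamma>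
      using that q(2)[of \<gamma>] pq[of \<gamma>] by (auto simp: B_def)
  qed
  obtain \<gamma> \<rho> where less: "\<And>m \<alpha>. m \<le> N \<delta> \<Longrightarrow> \<alpha> \<in> B (q \<gamma>) \<Longrightarrow> \<alpha> < p (q (\<rho> m))"
    and osc: "\<And>m \<alpha>. m \<le> N \<delta> \<Longrightarrow> \<alpha> \<in> B (q \<gamma>) \<Longrightarrow> osc \<alpha> (p (q (\<rho> m))) = osc \<alpha> (p (q (\<rho> 0))) + m"
    using F.osc_increments[of "N \<delta>"] by metis
  define \<beta> where "\<beta> = p (q \<gamma>)"
  have "\<forall>\<alpha>\<in>B (q \<gamma>). w z (p (q (\<rho> 0))) \<alpha> \<in> unit_circle \<and> w z \<beta> \<alpha> \<in> unit_circle"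
    by (simp add: w_circle)
  then obtain m where m: "m \<le> N \<delta>"
    "\<And>\<alpha>. \<alpha> \<in> B (q \<gamma>) \<Longrightarrow> norm (w z (p (q (\<rho> 0))) \<alpha> * z \<alpha> ^ m - w z \<beta> \<alpha>) < \<epsilon> \<beta>"
    using N[of "q \<gamma>"] unfolding dense_def q_N \<beta>_def by metis
  define \<beta>' where "\<beta>' = p (q (\<rho> m))"
  have \<beta>\<beta>': "\<beta> < \<beta>'"
    using less[OF m(1), of \<beta>] by (simp add: \<beta>_def \<beta>'_def B_def)
  \<comment> \<open>Indices in \<open>Q\<close> are closed under \<open>p\<close>, so \<open>p\<close> preserves their order and \<open>\<beta> < \<beta>'\<close> transfers to the indices.\<close>
  have "q \<gamma> < q (\<rho> m)"
  proof (rule ccontr)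
    assume "\<not> q \<gamma> < q (\<rho> m)"
    then have "q (\<rho> m) < q \<gamma>"
      using \<beta>\<beta>' by (cases "q (\<rho> m) = q \<gamma>") (auto simp: \<beta>_def \<beta>'_def)
    then show False
      using q_p[of "q (\<rho> m)" \<gamma>] p_ge[of "q \<gamma>"] \<beta>\<beta>' by (simp add: \<beta>_def \<beta>'_def)
  qed
  then have "\<beta> < q (\<rho> m)"
    using q_p by (simp add: \<beta>_def)
  then have "\<beta>' \<notin> box (A \<beta>) (\<epsilon> \<beta>) \<beta>"
    using p pI by (simp add: \<beta>_def \<beta>'_def)
  moreover have "norm (w z \<beta>' \<alpha> - w z \<beta> \<alpha>) < \<epsilon> \<beta>" if \<alpha>: "\<alpha> \<in> A \<beta>" for \<alpha>
  proof (cases "\<alpha> < q \<gamma>")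
    case True
    then have "\<alpha> \<in> r"
      using \<alpha> q_r[of \<gamma>] by (auto simp: \<beta>_def)
    then have "osc \<alpha> \<beta> = osc \<alpha> \<beta>'"
      using restr_eqD[OF trans[OF q_t[of \<gamma>] q_t[of "\<rho> m", symmetric]]] by (simp add: \<beta>_def \<beta>'_def)
    moreover have "\<alpha> < \<beta>"
      using True p_ge[of "q \<gamma>"] by (simp add: \<beta>_def)
    ultimately show ?thesis
      using \<beta>\<beta>' pos by (simp add: w_below)
  next
    case False
    then have \<alpha>B: "\<alpha> \<in> B (q \<gamma>)"
      using \<alpha> by (simp add: B_def \<beta>_def)
    have "w z \<beta>' \<alpha> = w z (p (q (\<rho> 0))) \<alpha> * z \<alpha> ^ m"
      using osc[OF m(1) \<alpha>B] less[OF m(1) \<alpha>B] less[OF le0 \<alpha>B] by (simp add: \<beta>'_def w_below power_add)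
    then show ?thesis
      using m(2)[OF \<alpha>B] by simp
  qed
  ultimately show False
    by (simp add: box_def)
qed

lemma open_contains_box:
  assumes U: "openin (moore_space z) U" and \<beta>: "w z \<beta> \<in> U"
  shows "\<exists>A \<epsilon>. finite A \<and> \<epsilon> > 0 \<and> w z ` box A \<epsilon> \<beta> \<subseteq> U"
proof -
  obtain T where T: "openin (product_topology (\<lambda>_. top_of_set unit_circle) UNIV) T" "U = T \<inter> range (w z)"
    using U unfolding moore_space_def openin_subtopology by blast
  have "w z \<beta> \<in> T"
    using \<beta> T(2) by simp
  from product_topology_open_contains_basis[OF T(1) this]
  obtain X where X: "w z \<beta> \<in> Pi\<^sub>E UNIV X" "\<forall>i. openin (top_of_set unit_circle) (X i)"
    "finite {i. X i \<noteq> unit_circle}" "Pi\<^sub>E UNIV X \<subseteq> T"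
    unfolding topspace_euclidean_subtopology by blast
  have "\<exists>\<epsilon>>0. \<forall>y\<in>unit_circle. norm (y - w z \<beta> i) < \<epsilon> \<longrightarrow> y \<in> X i" for i
    using X(1,2) unfolding openin_euclidean_subtopology_iff
    by (metis PiE_mem UNIV_I dist_norm)
  then obtain \<epsilon> where \<epsilon>: "\<And>i. \<epsilon> i > 0"
    "\<And>i y. y \<in> unit_circle \<Longrightarrow> norm (y - w z \<beta> i) < \<epsilon> i \<Longrightarrow> y \<in> X i"
    by metis
  define A where "A = {i. X i \<noteq> unit_circle}"
  define \<epsilon>\<^sub>0 where "\<epsilon>\<^sub>0 = Min (insert 1 (\<epsilon> ` A))"
  have finA: "finite A"
    using X(3) by (simp add: A_def)
  have "\<epsilon>\<^sub>0 > 0"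
    unfolding \<epsilon>\<^sub>0_def using finA \<epsilon>(1) by simp
  moreover have "w z \<gamma> \<in> U" if \<gamma>: "\<gamma> \<in> box A \<epsilon>\<^sub>0 \<beta>" for \<gamma>
  proof -
    have "w z \<gamma> i \<in> X i" for i
    proof (cases "i \<in> A")
      case True
      then have "\<epsilon>\<^sub>0 \<le> \<epsilon> i"
        unfolding \<epsilon>\<^sub>0_def using finA by simp
      then show ?thesis
        using \<gamma> True \<epsilon>(2)[OF w_circle] by (fastforce simp: box_def)
    next
      case False
      then show ?thesis
        using w_circle by (simp add: A_def)
    qed
    then show ?thesis
      using X(4) T(2) by (auto simp: PiE_UNIV_domain)
  qed
  ultimately show ?thesis
    using finA by blast
qed

definition determined_below :: "'a \<Rightarrow> ('a \<Rightarrow> complex) set \<Rightarrow> bool"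
  where "determined_below \<delta> S \<longleftrightarrow>
    (\<forall>\<beta> \<gamma>. (\<forall>\<alpha><\<delta>. w z \<beta> \<alpha> = w z \<gamma> \<alpha>) \<longrightarrow> w z \<beta> \<in> S \<longrightarrow> w z \<gamma> \<in> S)"

lemma determined_below_mono: "determined_below \<delta> S \<Longrightarrow> \<delta> \<le> \<delta>' \<Longrightarrow> determined_below \<delta>' S"
  unfolding determined_below_def by (meson less_le_trans)

lemma open_determined:
  assumes U: "openin (moore_space z) U"
  shows "\<exists>\<delta>. determined_below \<delta> U"
proof -
  have "\<exists>A \<epsilon>. finite A \<and> \<epsilon> > (0::real) \<and> (w z \<beta> \<in> U \<longrightarrow> w z ` box A \<epsilon> \<beta> \<subseteq> U)" for \<beta>
  proof (cases "w z \<beta> \<in> U")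
    case True
    then show ?thesis
      using open_contains_box[OF U] by simp
  next
    case False
    then show ?thesis
      by (intro exI[of _ "{}"] exI[of _ 1]) simp
  qed
  then obtain A \<epsilon> where A: "\<And>\<beta>. finite (A \<beta>)" "\<And>\<beta>. \<epsilon> \<beta> > (0::real)"
    "\<And>\<beta>. w z \<beta> \<in> U \<Longrightarrow> w z ` box (A \<beta>) (\<epsilon> \<beta>) \<beta> \<subseteq> U"
    by metis
  define I where "I = {\<beta>. w z \<beta> \<in> U}"
  obtain \<delta>\<^sub>0 where \<delta>\<^sub>0: "I \<subseteq> (\<Union>\<beta>\<in>I \<inter> {..<\<delta>\<^sub>0}. box (A \<beta>) (\<epsilon> \<beta>) \<beta>)"
    using countable_subcover[OF A(1,2), of I] ..
  have "countable (\<Union>\<beta>\<in>{..<\<delta>\<^sub>0}. A \<beta>)"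
    using A(1) countable_lessThan by (intro countable_UN) (auto intro: countable_finite)
  then obtain \<delta> where \<delta>: "\<And>\<alpha>. \<alpha> \<in> (\<Union>\<beta>\<in>{..<\<delta>\<^sub>0}. A \<beta>) \<Longrightarrow> \<alpha> < \<delta>"
    by (rule countable_imp_strictly_bounded) blast
  have "w z \<gamma>' \<in> U" if eq: "\<forall>\<alpha><\<delta>. w z \<gamma> \<alpha> = w z \<gamma>' \<alpha>" and "w z \<gamma> \<in> U" for \<gamma> \<gamma>'
  proof -
    obtain \<beta> where \<beta>: "w z \<beta> \<in> U" "\<beta> < \<delta>\<^sub>0" "\<gamma> \<in> box (A \<beta>) (\<epsilon> \<beta>) \<beta>"
      using \<delta>\<^sub>0 \<open>w z \<gamma> \<in> U\<close> by (auto simp: I_def)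
    have "w z \<gamma> \<alpha> = w z \<gamma>' \<alpha>" if "\<alpha> \<in> A \<beta>" for \<alpha>
      using eq \<delta>[of \<alpha>] \<beta>(2) that by blast
    then have "\<gamma>' \<in> box (A \<beta>) (\<epsilon> \<beta>) \<beta>"
      using \<beta>(3) by (simp add: box_def)
    then show ?thesis
      using A(3)[OF \<beta>(1)] by blast
  qed
  then show ?thesis
    unfolding determined_below_def by blast
qed

text \<open>Being decided below \<open>\<delta>\<close> is preserved by intersections and by enlarging \<open>\<delta>\<close>, and countably many
  ordinals have a common bound.\<close>

lemma gdelta_determined:
  assumes "gdelta_in (moore_space z) S"
  shows "\<exists>\<delta>. determined_below \<delta> S"
proof -
  obtain \<U> where \<U>: "countable \<U>" "\<And>U. U \<in> \<U> \<Longrightarrow> openin (moore_space z) U" "S = \<Inter>\<U>"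
    using assms unfolding gdelta_in_alt intersection_of_def by auto
  have "\<forall>U\<in>\<U>. \<exists>\<delta>. determined_below \<delta> U"
    using \<U>(2) open_determined by blast
  then obtain d where d: "\<And>U. U \<in> \<U> \<Longrightarrow> determined_below (d U) U"
    by metis
  have "countable (d ` \<U>)"
    using \<U>(1) by simp
  then obtain \<delta> where "\<And>x. x \<in> d ` \<U> \<Longrightarrow> x < \<delta>"
    by (rule countable_imp_strictly_bounded) blast
  then have "determined_below \<delta> U" if "U \<in> \<U>" for U
    using d that determined_below_mono by (meson imageI less_imp_le)
  then have "determined_below \<delta> S"
    unfolding \<U>(3) determined_below_def by blast
  then show ?thesis ..
qed

section \<open>A set that no countable set of coordinates determines\<close>

text \<open>Let \<open>b \<delta> < c \<delta>\<close> be a pair above \<open>\<delta>\<close> that agrees below \<open>\<delta>\<close>. For \<open>\<delta>\<close> in the closed unbounded set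
  \<open>D\<close> the intervals from \<open>\<delta>\<close> to \<open>c \<delta>\<close> are disjoint, so \<open>b ` D\<close> contains the lower point of
  each of these pairs and never the upper one.\<close>

lemma undetermined_set_exists: "\<exists>A. \<forall>\<delta>. \<not> determined_below \<delta> (w z ` A)"
proof -
  have "\<exists>p. \<delta> \<le> fst p \<and> fst p < snd p \<and> (\<forall>\<alpha><\<delta>. w z (fst p) \<alpha> = w z (snd p) \<alpha>)" for \<delta>
    using indistinguishable_pair[of \<delta> z] by force
  then obtain p where p: "\<forall>\<delta>. \<delta> \<le> fst (p \<delta>) \<and> fst (p \<delta>) < snd (p \<delta>) \<and>
      (\<forall>\<alpha><\<delta>. w z (fst (p \<delta>)) \<alpha> = w z (snd (p \<delta>)) \<alpha>)"
    using choice[of "\<lambda>\<delta> p. \<delta> \<le> fst p \<and> fst p < snd p \<and> (\<forall>\<alpha><\<delta>. w z (fst p) \<alpha> = w z (snd p) \<alpha>)"]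
    by blast
  define b c where "b \<delta> = fst (p \<delta>)" and "c \<delta> = snd (p \<delta>)" for \<delta>
  have bc: "\<delta> \<le> b \<delta>" "b \<delta> < c \<delta>" "\<And>\<alpha>. \<alpha> < \<delta> \<Longrightarrow> w z (b \<delta>) \<alpha> = w z (c \<delta>) \<alpha>" for \<delta>
    using p by (simp_all add: b_def c_def)
  define D where "D = {\<delta>. \<forall>\<eta><\<delta>. c \<eta> < \<delta>}"
  have "c \<delta> \<notin> b ` D" if "\<delta> \<in> D" for \<delta>
  proof
    assume "c \<delta> \<in> b ` D"
    then obtain \<delta>' where \<delta>': "\<delta>' \<in> D" "c \<delta> = b \<delta>'"
      by blast
    consider "\<delta>' < \<delta>" | "\<delta>' = \<delta>" | "\<delta> < \<delta>'"
      by (meson linorder_less_linear)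
    then show False
    proof cases
      case 1
      then have "c \<delta>' < \<delta>"
        using \<open>\<delta> \<in> D\<close> by (simp add: D_def)
      then show False
        using bc(2)[of \<delta>'] bc(1)[of \<delta>] bc(2)[of \<delta>] \<delta>'(2) by simp
    next
      case 2
      then show False
        using bc(2)[of \<delta>] \<delta>'(2) by simp
    next
      case 3
      then have "c \<delta> < \<delta>'"
        using \<delta>'(1) by (simp add: D_def)
      then show False
        using bc(1)[of \<delta>'] \<delta>'(2) by simp
    qed
  qed
  moreover have "\<exists>\<delta>'\<in>D. \<delta> < \<delta>'" for \<delta>
  proof -
    obtain \<delta>' where "reflecting (\<lambda>\<gamma>. {{c \<gamma>}}) \<delta>'" "\<delta> < \<delta>'"
      by (rule reflecting_exists[of "\<lambda>\<gamma>. {{c \<gamma>}}" \<delta>]) auto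
    then show ?thesis
      using reflecting_singleton[of "\<lambda>\<gamma>. {{c \<gamma>}}" \<delta>'] by (auto simp: D_def)
  qed
  ultimately have "\<not> determined_below \<delta> (w z ` (b ` D))" for \<delta>
  proof -
    obtain \<delta>' where \<delta>': "\<delta>' \<in> D" "\<delta> < \<delta>'"
      using \<open>\<And>\<delta>. \<exists>\<delta>'\<in>D. \<delta> < \<delta>'\<close> by blast
    have "w z (b \<delta>') \<in> w z ` (b ` D)" "w z (c \<delta>') \<notin> w z ` (b ` D)"
      using \<delta>'(1) \<open>\<And>\<delta>. \<delta> \<in> D \<Longrightarrow> c \<delta> \<notin> b ` D\<close> by (auto simp: inj_image_mem_iff[OF inj_w])
    moreover have "\<forall>\<alpha><\<delta>. w z (b \<delta>') \<alpha> = w z (c \<delta>') \<alpha>"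
      using bc(3) \<delta>'(2) by simp
    ultimately show ?thesis
      unfolding determined_below_def by blast
  qed
  then show ?thesis
    by blast
qed

theorem not_Q_set_space: "\<not> Q_set_space (moore_space z)"
proof
  assume "Q_set_space (moore_space z)"
  then have G: "S \<subseteq> topspace (moore_space z) \<Longrightarrow> gdelta_in (moore_space z) S" for S
    unfolding Q_set_space_def by (elim conjE allE[of _ S] mp)
  obtain A where A: "\<And>\<delta>. \<not> determined_below \<delta> (w z ` A)"
    using undetermined_set_exists by metis
  have "topspace (moore_space z) = range (w z)"
    using w_circle by (auto simp: moore_space_def PiE_UNIV_domain)
  then have "w z ` A \<subseteq> topspace (moore_space z)"
    by (simp add: image_mono)
  then obtain \<delta> where "determined_below \<delta> (w z ` A)"
    using gdelta_determined[OF G] by blast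
  then show False
    using A by blast
qed

end

theorem theorem4:
  fixes C :: "'a::omega1 \<Rightarrow> 'a set"
    and z :: "'a \<Rightarrow> complex"
  assumes "C_sequence C"
    and "range z \<subseteq> unit_circle"
    and "rationally_independent z"
  shows "\<not> Q_set_space (C_sequence.moore_space C z)"
proof -
  interpret moore_data C z
    using assms by (intro moore_data.intro moore_data_axioms.intro)
  show ?thesis
    by (rule not_Q_set_space)
qed

end
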